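(* Let $f:\mathbb{R}^n\to\mathbb{R}$ be convex and differentiable with coordinate Lipschitz constant $L_c$, let $h(x)=\sum_{i=1}^n h_i(x_i)$ with each $h_i$ convex, put $F=f+h$, and let $x^*$ be a minimizer of $F$. Let $(x^k),(z^k)$ be generated by the AASCD iteration described in the context, with parameters $\theta^k$, step size $\gamma>0$, and delays satisfying $\max(0,k-\tau)\le j(k)\le k$, where $\tau\le\sqrt n$. (i) If $2\gamma L_c+\left(1+\frac1n\right)\gamma L_c\left(\frac{\tau^2+\tau}{n}+2\tau\right)^2\le1$ and $\theta^k=\frac{2}{2n+k}$ (in particular $\theta^{-1}:=\frac{2}{2n-1}$), then for every $K\ge0$ $$\frac{\mathbb{E}[F(x^{K+1})]-F(x^* )}{(\theta^K)^2}+\frac{n^2}{2\gamma}\mathbb{E}\|z^{K+1}-x^*\|^2\le\frac{F(x^0)-F(x^* )}{(\theta^{-1})^2}+\frac{n^2}{2\gamma}\|z^0-x^*\|^2 .$$ (ii) If $h$ is strongly convex with modulus $\mu$, $0<\mu\le L_c$, if $2\gamma L_c+\left(\frac34+\frac{3}{8n}\right)\gamma L_c\left(\frac{\tau^2+\tau}{n}+2\tau\right)^2\le1$, and if $\theta^k=\theta:=\frac{-\gamma\mu+\sqrt{\gamma^2\mu^2+4\gamma\mu}}{2n}$ for all $k$, then for every $K\ge0$ $$\mathbb{E}[F(x^{K+1})]-F(x^* )\le(1-\theta)^{K+1}\left(F(x^0)-F(x^* )+\frac{n^2\theta^2+n\theta\mu\gamma}{2\gamma}\|z^0-x^*\|^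2\right).$$
   Context: Norms are Euclidean; $x_i$ and $\nabla_i f$ denote the $i$-th coordinate of $x$ and the $i$-th partial derivative of $f$. Coordinate Lipschitz condition: $|\nabla_i f(x)-\nabla_i f(y)|\le L_i|x_i-y_i|$ for all $x,y\in\mathbb{R}^n$ and $1\le i\le n$; $L_c=\max_i L_i$, and for simplicity all $L_i$ are assumed equal to $L_c$. Each $h_i:\mathbb{R}\to\mathbb{R}\cup\{+\infty\}$ is proper, lower semicontinuous and convex; $h$ is strongly convex with modulus $\mu$ if $h-\frac{\mu}{2}\|\cdot\|^2$ is convex. Superscripts on $x,y,z,w,\theta,a$ are iteration indices, except that $(\theta^K)^2,(\theta^{-1})^2$ are squares of the parameters with index $K$ and $-1$, and in (ii) $\theta^2$ and $(1-\theta)^{K+1}$ are powers. Delay model (bounded delay, consistent read): $(j(k))_{k\ge0}$ is a given deterministic sequence of integers with $\max(0,k-\tau)\le j(k)\le k$. AASCD iteration. Start from $x^0=z^0=0$. Put $a^k=\frac{\theta^k(1-\theta^{k-1})}{\theta^{k-1}}$ for $k\ge1$, $b(l,k)=\prod_{i=l}^k a^i$ for $l\le k$, and $y^k=(1-\theta^k)x^k+\theta^kz^k$. For $k=0,1,2,\dots$: 1. $w^{j(k)}=y^{j(k)}+\Big(\sum_{i=j(k)+1}^{k}b(j(k)+1,i)\Big)\big(y^{j(k)}-x^{j(k)}\big)$ (so $w^{j(k)}=y^k$ if $j(k)=k$); 2. choose $i_k$ uniformly at random from $\{1,\dots,n\}$, independently of the past; 3. $\delta^k=\arg\min_{\delta\in\mathbb{R}}\;h_{i_k}(z^k_{i_k}+\delta)+\nabla_{i_k}f(w^{j(k)})\,\delta+\frac{n\theta^k}{2\gamma}\delta^2$;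 4. $z^{k+1}_{i_k}=z^k_{i_k}+\delta^k$, other coordinates of $z^{k+1}$ equal to those of $z^k$; 5. $x^{k+1}=(1-\theta^k)x^k+n\theta^kz^{k+1}-(n-1)\theta^kz^k$. $\mathbb{E}$ is expectation over all the random indices. *)

theory Defs
  imports "HOL-Probability.Probability"
begin

definition partial_deriv :: "'n::finite \<Rightarrow> (real ^ 'n \<Rightarrow> real) \<Rightarrow> real ^ 'n \<Rightarrow> real" where
  "partial_deriv i f x = deriv (\<lambda>t. f (x + t *\<^sub>R axis i 1)) 0"

(* The points x and y are arbitrary; they may differ in coordinates other than i. *)
definition coord_lipschitz :: "(real ^ 'n::finite \<Rightarrow> real) \<Rightarrow> real \<Rightarrow> bool" where
  "coord_lipschitz f L \<longleftrightarrow>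
     (\<forall>i x y. \<bar>partial_deriv i f x - partial_deriv i f y\<bar> \<le> L * \<bar>x $ i - y $ i\<bar>)"

definition proper_fun :: "('a \<Rightarrow> ereal) \<Rightarrow> bool" where
  "proper_fun g \<longleftrightarrow> (\<forall>x. g x \<noteq> -\<infinity>) \<and> (\<exists>x. g x \<noteq> \<infinity>)"

definition lower_semicontinuous :: "('a::topological_space \<Rightarrow> ereal) \<Rightarrow> bool" where
  "lower_semicontinuous g \<longleftrightarrow> (\<forall>x. g x \<le> Liminf (at x) g)"

(* Used only for functions that never take the value -\<infinity>, so that the right-hand side
   contains no sum of opposite infinities. The endpoints u = 0 and v = 0 are harmless
   because 0 * \<infinity> = 0 in ereal. *)
definition ereal_convex :: "('a::real_vector \<Rightarrow> ereal) \<Rightarrow> bool" where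
  "ereal_convex g \<longleftrightarrow>
     (\<forall>x y. \<forall>u\<ge>0. \<forall>v\<ge>0. u + v = 1 \<longrightarrow>
        g (u *\<^sub>R x + v *\<^sub>R y) \<le> ereal u * g x + ereal v * g y)"

definition strongly_convex :: "('a::real_normed_vector \<Rightarrow> ereal) \<Rightarrow> real \<Rightarrow> bool" where
  "strongly_convex g \<mu> \<longleftrightarrow> ereal_convex (\<lambda>x. g x - ereal (\<mu> / 2 * (norm x)\<^sup>2))"

definition separable_sum :: "('n::finite \<Rightarrow> real \<Rightarrow> ereal) \<Rightarrow> real ^ 'n \<Rightarrow> ereal" where
  "separable_sum h x = (\<Sum>i\<in>UNIV. h i (x $ i))"

(* The Bochner integral is real-valued only, so the expectation of an extended-real random
   variable is E[X+] - E[X-]. (The ennreal conversion maps negative values to 0.) *)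
definition ereal_expectation :: "'a measure \<Rightarrow> ('a \<Rightarrow> ereal) \<Rightarrow> ereal" where
  "ereal_expectation M X =
     enn2ereal (\<integral>\<^sup>+ \<omega>. e2ennreal (X \<omega>) \<partial>M) - enn2ereal (\<integral>\<^sup>+ \<omega>. e2ennreal (- X \<omega>) \<partial>M)"

(* Only meant for k \<ge> 1. *)
definition momentum :: "(nat \<Rightarrow> real) \<Rightarrow> nat \<Rightarrow> real" where
  "momentum \<theta> k = \<theta> k * (1 - \<theta> (k - 1)) / \<theta> (k - 1)"

definition momentum_prod :: "(nat \<Rightarrow> real) \<Rightarrow> nat \<Rightarrow> nat \<Rightarrow> real" where
  "momentum_prod \<theta> l k = (\<Prod>i=l..k. momentum \<theta> i)"

definition extrapolation ::
  "(nat \<Rightarrow> real) \<Rightarrow> (nat \<Rightarrow> real ^ 'n) \<Rightarrow> (nat \<Rightarrow> real ^ 'n) \<Rightarrow> nat \<Rightarrow> real ^ 'n" where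
  "extrapolation \<theta> x z k = (1 - \<theta> k) *\<^sub>R x k + \<theta> k *\<^sub>R z k"

(* The point at which step k evaluates the gradient. It depends on k and not only on the
   delayed index j k. *)
definition compensated ::
  "(nat \<Rightarrow> real) \<Rightarrow> (nat \<Rightarrow> nat) \<Rightarrow> (nat \<Rightarrow> real ^ 'n) \<Rightarrow> (nat \<Rightarrow> real ^ 'n) \<Rightarrow> nat \<Rightarrow> real ^ 'n" where
  "compensated \<theta> j x z k =
     (let y = extrapolation \<theta> x z (j k) in
      y + (\<Sum>i=j k + 1..k. momentum_prod \<theta> (j k + 1) i) *\<^sub>R (y - x (j k)))"

(* One sample path: c k is the coordinate chosen in step k. *)
definition aascd_path ::
  "(real ^ 'n::finite \<Rightarrow> real) \<Rightarrow> ('n \<Rightarrow> real \<Rightarrow> ereal) \<Rightarrow> (nat \<Rightarrow> real) \<Rightarrow> real \<Rightarrow> (nat \<Rightarrow> nat) \<Rightarrow>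
   (nat \<Rightarrow> 'n) \<Rightarrow> (nat \<Rightarrow> real ^ 'n) \<Rightarrow> (nat \<Rightarrow> real ^ 'n) \<Rightarrow> bool" where
  "aascd_path f h \<theta> \<gamma> j c x z \<longleftrightarrow>
     x 0 = 0 \<and> z 0 = 0 \<and>
     (\<forall>k. \<exists>\<delta>.
        is_arg_min
          (\<lambda>d. h (c k) (z k $ c k + d) +
               ereal (partial_deriv (c k) f (compensated \<theta> j x z k) * d
                      + real CARD('n) * \<theta> k / (2 * \<gamma>) * d\<^sup>2))
          (\<lambda>_. True) \<delta> \<and>
        z (Suc k) = (\<chi> i. if i = c k then z k $ i + \<delta> else z k $ i) \<and>
        x (Suc k) = (1 - \<theta> k) *\<^sub>R x k + (real CARD('n) * \<theta> k) *\<^sub>R z (Suc k)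
                    - ((real CARD('n) - 1) * \<theta> k) *\<^sub>R z k)"

(* The coordinates c 0, c 1, ... are i.i.d. uniform. As the iterates up to step k are determined
   by the earlier coordinates, this is the same as each c k being uniform and independent
   of the past. *)
definition uniform_coordinates :: "'a measure \<Rightarrow> (nat \<Rightarrow> 'a \<Rightarrow> 'n::finite) \<Rightarrow> bool" where
  "uniform_coordinates M c \<longleftrightarrow>
     prob_space M \<and>
     prob_space.indep_vars M (\<lambda>_. count_space UNIV) c UNIV \<and>
     (\<forall>k i. measure M {\<omega> \<in> space M. c k \<omega> = i} = 1 / real CARD('n))"

end

theory Submission
  imports Defs
begin

text \<open>
  The coordinate condition makes the gradient of \<^term>\<open>f\<close> Lipschitz with constant \<open>L\<close> in the
  Euclidean norm. In step \<open>k\<close> the objective at \<open>x\<^sup>k\<^sup>+\<^sup>1\<close> is compared, through the delayed point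
  \<open>w\<close>, with the one at \<open>x\<^sup>k\<close> and at the minimizer: convexity gives lower bounds at \<open>w\<close>, the descent
  inequality an upper bound, and the strong convexity of the proximal subproblem telescopes
  \<open>\<parallel>z - x\<^sup>*\<parallel>\<^sup>2\<close>. Since \<open>x\<^sup>k\<close> is a convex combination of \<open>z\<^sup>0, \<dots>, z\<^sup>k\<close>, the value of \<open>h\<close> at \<open>x\<^sup>k\<close> may be
  replaced by the same combination of the values at the \<open>z\<^sup>l\<close>, which is affine in the random
  update. The momentum compensation leaves the error
  \<open>\<parallel>y\<^sup>k - w\<parallel> \<le> \<Sum> (n + k - m) \<theta>\<^sup>m \<parallel>z\<^sup>m\<^sup>+\<^sup>1 - z\<^sup>m\<parallel>\<close>, summed over the delay window; after summation over
  \<open>k\<close> the step size condition lets the negative terms \<open>\<parallel>z\<^sup>m\<^sup>+\<^sup>1 - z\<^sup>m\<parallel>\<^sup>2\<close> absorb it.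
\<close>

section \<open>Smoothness and proximal steps\<close>

definition gradient :: "(real ^ 'n::finite \<Rightarrow> real) \<Rightarrow> real ^ 'n \<Rightarrow> real ^ 'n" where
  "gradient f p = (\<chi> i. partial_deriv i f p)"

text \<open>\<open>partial_deriv\<close> only looks along one axis. Where \<open>f\<close> is
  differentiable, its values are those of the Frechet derivative on the basis vectors, so linearity
  yields every directional derivative.\<close>

lemma has_real_derivative_along_line:
  fixes f :: "real ^ 'n::finite \<Rightarrow> real"
  assumes "f differentiable (at (p + t *\<^sub>R d))"
  shows "((\<lambda>s. f (p + s *\<^sub>R d)) has_real_derivative gradient f (p + t *\<^sub>R d) \<bullet> d) (at t)"
proof -
  let ?p = "p + t *\<^sub>R d"
  obtain f' where f': "(f has_derivative f') (at ?p)"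
    using assms by (auto simp: differentiable_def)
  interpret f': bounded_linear f' using f' by (rule has_derivative_bounded_linear)
  have line: "((\<lambda>s. f (q + s *\<^sub>R e)) has_real_derivative f' e) (at u)"
    if "q + u *\<^sub>R e = ?p" for q e u
  proof -
    have "((\<lambda>s. q + s *\<^sub>R e) has_derivative (\<lambda>s. s *\<^sub>R e)) (at u)"
      by (auto intro!: derivative_eq_intros)
    from has_derivative_compose[OF this, of f f'] f' that
    have "((\<lambda>s. f (q + s *\<^sub>R e)) has_derivative (\<lambda>s. f' (s *\<^sub>R e))) (at u)" by simp
    then show ?thesis
      by (simp add: has_field_derivative_def f'.scaleR mult_commute_abs)
  qed
  have partial: "partial_deriv i f ?p = f' (axis i 1)" for i
    unfolding partial_deriv_def by (intro DERIV_imp_deriv line) simp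
  have "f' d = f' (\<Sum>i\<in>UNIV. (d $ i) *\<^sub>R axis i 1)"
    by (rule arg_cong[where f = f']) (simp add: vec_eq_iff axis_def if_distrib cong: if_cong)
  also have "\<dots> = gradient f ?p \<bullet> d"
    by (simp add: f'.sum f'.scaleR inner_vec_def gradient_def partial mult.commute)
  finally show ?thesis using line[of p t d] by simp
qed

text \<open>Restricted to the line through \<open>w\<close> and \<open>u\<close>, this is the scalar
  tangent inequality between the parameters 0 and 1.\<close>

lemma convex_above_tangent:
  fixes f :: "real ^ 'n::finite \<Rightarrow> real"
  assumes "convex_on UNIV f" and "f differentiable (at w)"
  shows "f w + gradient f w \<bullet> (u - w) \<le> f u"
proof -
  let ?g = "\<lambda>s. f (w + s *\<^sub>R (u - w))"
  have "convex_on UNIV ?g"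
  proof (rule convex_onI)
    fix t a b :: real assume t: "0 < t" "t < 1"
    have "w + ((1 - t) *\<^sub>R a + t *\<^sub>R b) *\<^sub>R (u - w)
        = (1 - t) *\<^sub>R (w + a *\<^sub>R (u - w)) + t *\<^sub>R (w + b *\<^sub>R (u - w))"
      by (simp add: algebra_simps)
    then show "?g ((1 - t) *\<^sub>R a + t *\<^sub>R b) \<le> (1 - t) * ?g a + t * ?g b"
      using convex_onD[OF assms(1), of t] t by simp
  qed simp
  moreover have "(?g has_real_derivative gradient f w \<bullet> (u - w)) (at 0 within UNIV)"
    using has_real_derivative_along_line[of f w 0 "u - w"] assms(2) by simp
  ultimately have "?g 1 - ?g 0 \<ge> gradient f w \<bullet> (u - w) * (1 - 0)"
    by (intro convex_on_imp_above_tangent[of UNIV]) auto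
  then show ?thesis by simp
qed

text \<open>The quadratic model minus \<open>f\<close> is nondecreasing along the segment. The
  coordinate condition covers arbitrary pairs of points, so each partial derivative changes by at
  most \<open>L * s\<close> times the size of \<open>d $ i\<close>, and the constant stays
  \<open>L\<close> with no factor for the dimension.\<close>

lemma descent_inequality:
  fixes f :: "real ^ 'n::finite \<Rightarrow> real"
  assumes diff: "\<And>u. f differentiable (at u)" and lip: "coord_lipschitz f L"
  shows "f u \<le> f w + gradient f w \<bullet> (u - w) + L / 2 * (norm (u - w))\<^sup>2"
proof -
  define d where "d = u - w"
  let ?g = "\<lambda>s. gradient f w \<bullet> d * s + L / 2 * (norm d)\<^sup>2 * s\<^sup>2 - f (w + s *\<^sub>R d)"
  let ?g' = "\<lambda>s. gradient f w \<bullet> d + L * (norm d)\<^sup>2 * s - gradient f (w + s *\<^sub>R d) \<bullet> d"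
  have "?g 0 \<le> ?g 1"
  proof (rule DERIV_nonneg_imp_nondecreasing[of 0 1])
    fix s :: real assume s: "0 \<le> s" "s \<le> 1"
    have "(?g has_real_derivative ?g' s) (at s)"
      using has_real_derivative_along_line[OF diff, of w d s]
      by (auto intro!: derivative_eq_intros)
    moreover have "gradient f (w + s *\<^sub>R d) \<bullet> d - gradient f w \<bullet> d \<le> L * (norm d)\<^sup>2 * s"
    proof -
      have "gradient f (w + s *\<^sub>R d) \<bullet> d - gradient f w \<bullet> d
          = (\<Sum>i\<in>UNIV. (partial_deriv i f (w + s *\<^sub>R d) - partial_deriv i f w) * d $ i)"
        by (simp add: inner_vec_def gradient_def sum_subtractf left_diff_distrib)
      also have "\<dots> \<le> (\<Sum>i\<in>UNIV. L * s * (d $ i)\<^sup>2)"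
      proof (rule sum_mono)
        fix i
        have "\<bar>partial_deriv i f (w + s *\<^sub>R d) - partial_deriv i f w\<bar> \<le> L * \<bar>s * d $ i\<bar>"
          using lip[unfolded coord_lipschitz_def, rule_format, of i "w + s *\<^sub>R d" w] by simp
        from mult_right_mono[OF this abs_ge_zero[of "d $ i"]] s
        have "\<bar>(partial_deriv i f (w + s *\<^sub>R d) - partial_deriv i f w) * d $ i\<bar> \<le> L * s * (d $ i)\<^sup>2"
          by (simp add: abs_mult mult.assoc power2_eq_square)
        then show "(partial_deriv i f (w + s *\<^sub>R d) - partial_deriv i f w) * d $ i \<le> L * s * (d $ i)\<^sup>2"
          by linarith
      qed
      also have "\<dots> = L * (norm d)\<^sup>2 * s"
        unfolding power2_norm_eq_inner
        by (simp add: inner_vec_def sum_distrib_left power2_eq_square ac_simps)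
      finally show ?thesis .
    qed
    ultimately show "\<exists>y. (?g has_real_derivative y) (at s) \<and> y \<ge> 0" by force
  qed simp
  then show ?thesis by (simp add: d_def)
qed

lemma coord_lipschitz_nonneg:
  fixes f :: "real ^ 'n::finite \<Rightarrow> real"
  assumes "coord_lipschitz f L"
  shows "0 \<le> L"
  \<comment> \<open>The two points differ by exactly 1 in the chosen coordinate, so the right-hand
    side of the condition is \<open>L\<close>.\<close>
  using assms[unfolded coord_lipschitz_def, rule_format, of undefined "axis undefined 1" 0]
  by (simp add: axis_def)

text \<open>The proximal objective has convexity modulus \<open>2 * q + \<mu>\<close>, hence grows
  quadratically away from its minimizer \<open>p\<close>. Comparing \<open>p\<close> with points of
  the segment towards \<open>a\<close> shows this without differentiating \<open>H\<close>.\<close>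

lemma three_point_inequality:
  fixes H :: "real \<Rightarrow> real"
  assumes conv: "convex_on D (\<lambda>t. H t - \<mu> / 2 * t\<^sup>2)"
    and D: "a \<in> D" "p \<in> D"
    and min: "\<And>b. b \<in> D \<Longrightarrow> H p + g * p + q * (p - z)\<^sup>2 \<le> H b + g * b + q * (b - z)\<^sup>2"
  shows "H p + g * p + q * (p - z)\<^sup>2 + (q + \<mu> / 2) * (p - a)\<^sup>2 \<le> H a + g * a + q * (a - z)\<^sup>2"
proof -
  define P where "P b = H b + g * b + q * (b - z)\<^sup>2" for b
  define m where "m = (q + \<mu> / 2) * (p - a)\<^sup>2"
  have "P p + m * (1 - t) \<le> P a" if t: "0 < t" "t < 1" for t
  proof -
    let ?b = "(1 - t) * p + t * a"
    have b: "?b \<in> D"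
      using convexD[OF convex_on_imp_convex[OF conv] D(2) D(1), of "1 - t" t] t by simp
    have "H ?b - \<mu> / 2 * ?b\<^sup>2 \<le> (1 - t) * (H p - \<mu> / 2 * p\<^sup>2) + t * (H a - \<mu> / 2 * a\<^sup>2)"
      using convex_onD[OF conv _ _ D(2) D(1), of t] t by simp
    moreover have "P p \<le> P ?b" using min[OF b] by (simp add: P_def)
    ultimately have "P p \<le> (1 - t) * (H p - \<mu> / 2 * p\<^sup>2) + t * (H a - \<mu> / 2 * a\<^sup>2)
        + \<mu> / 2 * ?b\<^sup>2 + g * ?b + q * (?b - z)\<^sup>2"
      unfolding P_def by linarith
    \<comment> \<open>On the segment a square loses \<open>t * (1 - t) * (p - a)\<^sup>2\<close>
      against its chord; the quadratic terms have total coefficient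
      \<open>q + \<mu> / 2\<close>.\<close>
    also have "\<dots> = (1 - t) * P p + t * P a - t * (m * (1 - t))"
      unfolding P_def m_def by (simp add: power2_eq_square field_simps)
    finally have "t * (P p + m * (1 - t)) \<le> t * P a" by (simp add: algebra_simps)
    then show ?thesis using t by simp
  qed
  then have "\<forall>\<^sub>F t in at_right 0. P p + m * (1 - t) \<le> P a"
    by (auto simp: eventually_at_right[of 0 1] intro!: exI[of _ 1])
  moreover have "((\<lambda>t. P p + m * (1 - t)) \<longlongrightarrow> P p + m * (1 - 0)) (at_right 0)"
    by (intro tendsto_intros)
  ultimately have "P p + m * (1 - 0) \<le> P a"
    by (intro tendsto_upperbound) auto
  then show ?thesis by (simp add: P_def m_def)
qed

section \<open>The delay error\<close>

text \<open>If \<open>z\<close> stood still from step \<open>j k\<close> on, the displacement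
  \<open>y - x\<close> would only be multiplied by the momentum factor in each step, and the
  compensated point would equal \<open>y\<close> at step \<open>k\<close>. A move of
  \<open>z\<close> in step \<open>m\<close> enters \<open>y\<close> once with factor
  \<open>n\<close>, and then through the displacement at each of the indices \<open>m + 1\<close> to
  \<open>k\<close>, never amplified; this gives the weight \<open>n + real (k - m)\<close>.\<close>

lemma delayed_extrapolation_error:
  fixes x z :: "nat \<Rightarrow> real ^ 'n::finite"
  defines "n \<equiv> real CARD('n)"
  assumes \<theta>: "\<And>m. 0 < \<theta> m" "\<And>m. \<theta> m \<le> 1 / n" "\<And>m. \<theta> (Suc m) \<le> \<theta> m"
    and x: "\<And>m. m < k \<Longrightarrow>
      x (Suc m) = (1 - \<theta> m) *\<^sub>R x m + (n * \<theta> m) *\<^sub>R z (Suc m) - ((n - 1) * \<theta> m) *\<^sub>R z m"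
    and jk: "j k \<le> k"
  shows "norm (extrapolation \<theta> x z k - compensated \<theta> j x z k)
    \<le> (\<Sum>m=j k..<k. (n + real (k - m)) * (\<theta> m * norm (z (Suc m) - z m)))"
proof -
  define y where "y = extrapolation \<theta> x z"
  define s where "s = j k"
  define u where "u m = y m - x m" for m
  \<comment> \<open>\<open>v\<close> is the deviation of the true displacement from the predicted
    one, and \<open>w m\<close> is the prediction of \<open>y m\<close>; the compensated point is
    \<open>w k\<close>.\<close>
  define v where "v m = u m - momentum_prod \<theta> (s + 1) m *\<^sub>R u s" for m
  define w where "w m = y s + (\<Sum>i=s + 1..m. momentum_prod \<theta> (s + 1) i) *\<^sub>R u s" for m
  define \<Delta> where "\<Delta> m = \<theta> m * norm (z (Suc m) - z m)" for m
  have n1: "1 \<le> n" by (simp add: n_def Suc_leI)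
  have \<theta>1: "n * \<theta> m \<le> 1" for m using \<theta>(2)[of m] n1 by (simp add: field_simps)
  have \<theta>2: "\<theta> m \<le> 1" for m
    using \<theta>(2)[of m] n1 by (meson divide_le_eq_1 order_trans le_cases not_one_le_zero order.strict_trans2 zero_less_one)
  have \<Delta>0: "0 \<le> \<Delta> m" for m using \<theta>(1)[of m] by (simp add: \<Delta>_def)
  have y_Suc: "y (Suc m) = y m + (n * \<theta> m) *\<^sub>R (z (Suc m) - z m) + u (Suc m)" if "m < k" for m
    unfolding u_def y_def extrapolation_def x[OF that] by (simp add: algebra_simps)
  have u_Suc: "u (Suc m) = momentum \<theta> (Suc m) *\<^sub>R u m
      + (\<theta> (Suc m) * (1 - n * \<theta> m)) *\<^sub>R (z (Suc m) - z m)" if "m < k" for m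
  proof -
    have u: "u i = \<theta> i *\<^sub>R (z i - x i)" for i
      by (simp add: u_def y_def extrapolation_def algebra_simps)
    have "momentum \<theta> (Suc m) *\<^sub>R u m = (\<theta> (Suc m) * (1 - \<theta> m)) *\<^sub>R (z m - x m)"
      using \<theta>(1)[of m] by (simp add: u momentum_def)
    then show ?thesis unfolding u[of "Suc m"] x[OF that] by (simp add: algebra_simps)
  qed
  have v_bound: "m \<le> k \<Longrightarrow> norm (v m) \<le> (\<Sum>i=s..<m. \<Delta> i)" if "s \<le> m" for m
    using that
  proof (induction m rule: dec_induct)
    case base
    \<comment> \<open>The empty product is 1, so \<open>v s = 0\<close>.\<close>
    then show ?case by (simp add: v_def momentum_prod_def)
  next
    case (step m)
    have "v (Suc m) = momentum \<theta> (Suc m) *\<^sub>R v m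
        + (\<theta> (Suc m) * (1 - n * \<theta> m)) *\<^sub>R (z (Suc m) - z m)"
      using u_Suc[of m] step by (simp add: v_def momentum_prod_def algebra_simps)
    moreover have "0 \<le> momentum \<theta> (Suc m)" "momentum \<theta> (Suc m) \<le> 1"
      using \<theta>(1)[of m] \<theta>(1)[of "Suc m"] \<theta>(3)[of m] \<theta>2[of m]
      by (auto simp: momentum_def divide_simps intro!: mult_nonneg_nonneg mult_mono[of _ "\<theta> m" _ 1, simplified])
    then have "norm (momentum \<theta> (Suc m) *\<^sub>R v m) \<le> norm (v m)"
      by (simp add: mult_left_le_one_le)
    moreover have "norm ((\<theta> (Suc m) * (1 - n * \<theta> m)) *\<^sub>R (z (Suc m) - z m)) \<le> \<Delta> m"
    proof -
      have "0 \<le> \<theta> (Suc m) * (1 - n * \<theta> m)"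
        using \<theta>(1)[of "Suc m"] \<theta>1[of m] by simp
      moreover have "\<theta> (Suc m) * (1 - n * \<theta> m) \<le> \<theta> m * 1"
        using \<theta>(1)[of m] \<theta>(1)[of "Suc m"] \<theta>(3)[of m] \<theta>1[of m] n1 by (intro mult_mono) auto
      ultimately show ?thesis by (simp add: \<Delta>_def mult_right_mono)
    qed
    ultimately have "norm (v (Suc m)) \<le> norm (v m) + \<Delta> m"
      by (smt (verit) norm_triangle_ineq)
    then show ?case using step by simp
  qed
  have "m \<le> k \<Longrightarrow> norm (y m - w m) \<le> (\<Sum>i=s..<m. (n + real (m - i)) * \<Delta> i)" if "s \<le> m" for m
    using that
  proof (induction m rule: dec_induct)
    case base
    then show ?case by (simp add: w_def)
  next
    case (step m)
    have "y (Suc m) - w (Suc m) = (y m - w m) + (n * \<theta> m) *\<^sub>R (z (Suc m) - z m) + v (Suc m)"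
      using y_Suc[of m] step by (simp add: w_def v_def algebra_simps)
    then have "norm (y (Suc m) - w (Suc m))
        \<le> norm (y m - w m) + norm ((n * \<theta> m) *\<^sub>R (z (Suc m) - z m)) + norm (v (Suc m))"
      by (metis norm_triangle_ineq norm_triangle_mono order_refl)
    also have "norm ((n * \<theta> m) *\<^sub>R (z (Suc m) - z m)) = n * \<Delta> m"
      using n1 \<theta>(1)[of m] by (simp add: \<Delta>_def abs_mult)
    also have "norm (v (Suc m)) \<le> (\<Sum>i=s..<Suc m. \<Delta> i)"
      using step by (intro v_bound) auto
    also have "norm (y m - w m) \<le> (\<Sum>i=s..<m. (n + real (m - i)) * \<Delta> i)"
      using step by simp
    also have "(\<Sum>i=s..<m. (n + real (m - i)) * \<Delta> i) + n * \<Delta> m + (\<Sum>i=s..<Suc m. \<Delta> i)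
        = (\<Sum>i=s..<m. (n + real (Suc m - i)) * \<Delta> i) + (n + 1) * \<Delta> m"
    proof -
      have "(\<Sum>i=s..<m. (n + real (m - i)) * \<Delta> i) + (\<Sum>i=s..<m. \<Delta> i)
          = (\<Sum>i=s..<m. (n + real (Suc m - i)) * \<Delta> i)"
        unfolding sum.distrib[symmetric]
        by (rule sum.cong) (auto simp: Suc_diff_le algebra_simps)
      then show ?thesis using step by (simp add: algebra_simps)
    qed
    finally show ?case using step by simp
  qed
  from this[of k] jk show ?thesis
    by (simp add: s_def y_def w_def u_def compensated_def Let_def \<Delta>_def)
qed

text \<open>The value is \<open>n / 2\<close> times the bracket that is squared in the step size
  conditions.\<close>

lemma sum_delay_weights:
  fixes n :: real
  shows "(\<Sum>s=1..\<tau>. n + real s) = n * real \<tau> + ((real \<tau>)\<^sup>2 + real \<tau>) / 2"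
  by (induction \<tau>) (auto simp: power2_eq_square field_simps)

lemma sum_delay_window_le:
  fixes n :: real
  assumes "k - \<tau> \<le> s" "s \<le> k" "0 \<le> n"
  shows "(\<Sum>m=s..<k. n + real (k - m)) \<le> n * real \<tau> + ((real \<tau>)\<^sup>2 + real \<tau>) / 2"
proof -
  have "(\<Sum>m=s..<k. n + real (k - m)) = (\<Sum>i=1..k - s. n + real i)"
    using assms(2) by (intro sum.reindex_bij_witness[of _ "\<lambda>i. k - i" "\<lambda>m. k - m"]) auto
  also have "\<dots> \<le> (\<Sum>i=1..\<tau>. n + real i)"
    using assms by (intro sum_mono2) auto
  finally show ?thesis unfolding sum_delay_weights .
qed

text \<open>After exchanging the sums, an index \<open>m\<close> occurs only for \<open>k\<close>
  between \<open>m + 1\<close> and \<open>m + \<tau>\<close>, so its total weight is at most the sum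
  of \<open>n + s\<close> over \<open>s = 1, ..., \<tau>\<close>.\<close>

lemma delayed_double_sum_le:
  fixes n :: real and g :: "nat \<Rightarrow> real"
  assumes j: "\<And>k. k - \<tau> \<le> j k" and n: "0 \<le> n" and g: "\<And>m. 0 \<le> g m"
  shows "(\<Sum>k<N. \<Sum>m=j k..<k. (n + real (k - m)) * g m)
    \<le> (n * real \<tau> + ((real \<tau>)\<^sup>2 + real \<tau>) / 2) * (\<Sum>m<N. g m)"
proof -
  have nonneg: "0 \<le> (n + real (k - m)) * g m" for k m
    using n g[of m] by simp
  have "(\<Sum>k<N. \<Sum>m=j k..<k. (n + real (k - m)) * g m)
      \<le> (\<Sum>k<N. \<Sum>m<N. if m < k \<and> k \<le> m + \<tau> then (n + real (k - m)) * g m else 0)"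
  proof (rule sum_mono)
    fix k assume "k \<in> {..<N}"
    then have "(\<Sum>m=j k..<k. (n + real (k - m)) * g m)
        \<le> (\<Sum>m\<in>{m\<in>{..<N}. m < k \<and> k \<le> m + \<tau>}. (n + real (k - m)) * g m)"
      using j[of k] by (intro sum_mono2 nonneg) auto
    also have "\<dots> = (\<Sum>m<N. if m < k \<and> k \<le> m + \<tau> then (n + real (k - m)) * g m else 0)"
      by (intro sum.inter_filter) simp
    finally show "(\<Sum>m=j k..<k. (n + real (k - m)) * g m) \<le> \<dots>" .
  qed
  also have "\<dots> = (\<Sum>m<N. \<Sum>k<N. if m < k \<and> k \<le> m + \<tau> then (n + real (k - m)) * g m else 0)"
    by (rule sum.swap)
  also have "\<dots> \<le> (\<Sum>m<N. (\<Sum>s=1..\<tau>. n + real s) * g m)"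
  proof (rule sum_mono)
    fix m
    have "(\<Sum>k<N. if m < k \<and> k \<le> m + \<tau> then (n + real (k - m)) * g m else 0)
        = (\<Sum>k\<in>{k\<in>{..<N}. m < k \<and> k \<le> m + \<tau>}. (n + real (k - m)) * g m)"
      by (intro sum.inter_filter[symmetric]) simp
    also have "\<dots> \<le> (\<Sum>k\<in>{m<..m + \<tau>}. (n + real (k - m)) * g m)"
      by (intro sum_mono2 nonneg) auto
    also have "\<dots> = (\<Sum>s=1..\<tau>. (n + real s) * g m)"
      by (intro sum.reindex_bij_witness[of _ "\<lambda>s. m + s" "\<lambda>k. k - m"]) auto
    finally show "(\<Sum>k<N. if m < k \<and> k \<le> m + \<tau> then (n + real (k - m)) * g m else 0)
        \<le> (\<Sum>s=1..\<tau>. n + real s) * g m" by (simp add: sum_distrib_right)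
  qed
  also have "\<dots> = (n * real \<tau> + ((real \<tau>)\<^sup>2 + real \<tau>) / 2) * (\<Sum>m<N. g m)"
    unfolding sum_delay_weights by (simp add: sum_distrib_left)
  finally show ?thesis .
qed

text \<open>Cauchy-Schwarz for the vectors \<open>sqrt (a i)\<close> and
  \<open>sqrt (a i) * p i\<close>.\<close>

lemma weighted_sum_squared_le:
  fixes a p :: "'b \<Rightarrow> real"
  assumes "\<And>i. i \<in> I \<Longrightarrow> 0 \<le> a i"
  shows "(\<Sum>i\<in>I. a i * p i)\<^sup>2 \<le> (\<Sum>i\<in>I. a i) * (\<Sum>i\<in>I. a i * (p i)\<^sup>2)"
proof -
  have "(\<Sum>i\<in>I. sqrt (a i) * (sqrt (a i) * p i))\<^sup>2
      \<le> (\<Sum>i\<in>I. (sqrt (a i))\<^sup>2) * (\<Sum>i\<in>I. (sqrt (a i) * p i)\<^sup>2)"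
    by (rule Cauchy_Schwarz_ineq_sum)
  then show ?thesis
    using assms by (simp add: power_mult_distrib mult.assoc[symmetric] cong: sum.cong)
qed

section \<open>One coordinate step\<close>

text \<open>The vector \<open>\<delta>\<close> collects the increments of all coordinates although a step applies only one of them;
  \<open>X i\<close> and \<open>Z i\<close> are the iterates if coordinate \<open>i\<close> is chosen.\<close>

lemma coordinate_step_inequality:
  fixes f :: "real ^ 'n::finite \<Rightarrow> real" and H :: "'n \<Rightarrow> real \<Rightarrow> real"
    and x y z w \<delta> xs :: "real ^ 'n" and X Z :: "'n \<Rightarrow> real ^ 'n" and \<eta>' :: "'n \<Rightarrow> real"
    and n A v L \<gamma> \<mu> \<theta> \<eta> :: real
  defines "n \<equiv> real CARD('n)"
    and "y \<equiv> (1 - \<theta>) *\<^sub>R x + \<theta> *\<^sub>R z"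
    and "A \<equiv> n * \<theta>\<^sup>2 / (2 * \<gamma>) + \<theta> * \<mu> / 2"
    and "X \<equiv> (\<lambda>i. y + (n * \<theta> * \<delta> $ i) *\<^sub>R axis i 1)"
    and "Z \<equiv> (\<lambda>i. z + (\<delta> $ i) *\<^sub>R axis i 1)"
    and "\<eta>' \<equiv> (\<lambda>i. (1 - \<theta>) * \<eta> + n * \<theta> * (\<Sum>l\<in>UNIV. H l (Z i $ l))
                     - (n - 1) * \<theta> * (\<Sum>l\<in>UNIV. H l (z $ l)))"
    and "v \<equiv> f xs + (\<Sum>i\<in>UNIV. H i (xs $ i))"
  assumes f: "convex_on UNIV f" "\<And>u. f differentiable (at u)" "coord_lipschitz f L"
    and \<theta>: "0 < \<theta>" "\<theta> \<le> 1"
    and three_point: "\<And>i. H i (z $ i + \<delta> $ i) + gradient f w $ i * (z $ i + \<delta> $ i)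
          + n * \<theta> / (2 * \<gamma>) * (\<delta> $ i)\<^sup>2
          + (n * \<theta> / (2 * \<gamma>) + \<mu> / 2) * (z $ i + \<delta> $ i - xs $ i)\<^sup>2
        \<le> H i (xs $ i) + gradient f w $ i * xs $ i + n * \<theta> / (2 * \<gamma>) * (xs $ i - z $ i)\<^sup>2"
  shows "(\<Sum>i\<in>UNIV. f (X i) + \<eta>' i) / n - v + A * (\<Sum>i\<in>UNIV. (norm (Z i - xs))\<^sup>2)
    \<le> (1 - \<theta>) * (f x + \<eta> - v) + ((n - 1) * A + n * \<theta>\<^sup>2 / (2 * \<gamma>)) * (norm (z - xs))\<^sup>2
      + L / 2 * (1 + 1 / n) * (norm (y - w))\<^sup>2 - n * \<theta>\<^sup>2 * (1 / (2 * \<gamma>) - L) * (norm \<delta>)\<^sup>2"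
proof -
  define g where "g = gradient f w"
  define q where "q = n * \<theta> / (2 * \<gamma>)"
  have n1: "1 \<le> n" by (simp add: n_def Suc_leI)
  have L0: "0 \<le> L" by (rule coord_lipschitz_nonneg[OF f(3)])
  have sq: "(norm u)\<^sup>2 = (\<Sum>i\<in>UNIV. (u $ i)\<^sup>2)" for u :: "real ^ 'n"
    unfolding power2_norm_eq_inner by (simp add: inner_vec_def power2_eq_square)
  \<comment> \<open>Each \<open>X i\<close> leaves \<open>y\<close> along one axis. Averaging over
    \<open>i\<close> later assembles the coordinate products into full inner products with
    \<open>\<delta>\<close>, and the factor \<open>n\<close> in the update cancels.\<close>
  have "f (X i) \<le> f w + g \<bullet> (y - w) + L / 2 * (norm (y - w))\<^sup>2
      + n * \<theta> * (g $ i * \<delta> $ i) + L * n * \<theta> * ((y - w) $ i * \<delta> $ i)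
      + L / 2 * (n * \<theta>)\<^sup>2 * (\<delta> $ i)\<^sup>2" for i
  proof -
    have Xw: "X i - w = (y - w) + (n * \<theta> * \<delta> $ i) *\<^sub>R axis i 1"
      by (simp add: X_def)
    have norm_Xw: "(norm (X i - w))\<^sup>2
        = (norm (y - w))\<^sup>2 + 2 * (n * \<theta> * \<delta> $ i) * (y - w) $ i + (n * \<theta> * \<delta> $ i)\<^sup>2"
      unfolding power2_norm_eq_inner Xw
      by (simp add: inner_add_left inner_add_right inner_axis inner_axis' power2_eq_square
          algebra_simps)
    have inner_Xw: "g \<bullet> (X i - w) = g \<bullet> (y - w) + n * \<theta> * \<delta> $ i * g $ i"
      unfolding Xw by (simp add: inner_add_right inner_axis)
    have "f (X i) \<le> f w + g \<bullet> (X i - w) + L / 2 * (norm (X i - w))\<^sup>2"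
      unfolding g_def using f(2,3) by (rule descent_inequality)
    then show ?thesis
      unfolding norm_Xw inner_Xw by (simp add: algebra_simps power_mult_distrib)
  qed
  then have "(\<Sum>i\<in>UNIV. f (X i)) \<le> (\<Sum>i\<in>UNIV. f w + g \<bullet> (y - w) + L / 2 * (norm (y - w))\<^sup>2
      + n * \<theta> * (g $ i * \<delta> $ i) + L * n * \<theta> * ((y - w) $ i * \<delta> $ i)
      + L / 2 * (n * \<theta>)\<^sup>2 * (\<delta> $ i)\<^sup>2)"
    by (rule sum_mono)
  also have "\<dots> = n * (f w + g \<bullet> (y - w) + L / 2 * (norm (y - w))\<^sup>2) + n * \<theta> * (g \<bullet> \<delta>)
      + L * n * \<theta> * ((y - w) \<bullet> \<delta>) + L / 2 * (n * \<theta>)\<^sup>2 * (norm \<delta>)\<^sup>2"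
    by (simp add: sum.distrib sum_distrib_left[symmetric] sum_divide_distrib[symmetric]
        inner_vec_def sq n_def distrib_left)
  also have "\<dots> = n * (f w + g \<bullet> (y - w) + L / 2 * (norm (y - w))\<^sup>2 + \<theta> * (g \<bullet> \<delta>)
      + L * (\<theta> * ((y - w) \<bullet> \<delta>)) + L / 2 * n * \<theta>\<^sup>2 * (norm \<delta>)\<^sup>2)"
    by (simp add: algebra_simps power2_eq_square)
  finally have smooth: "(\<Sum>i\<in>UNIV. f (X i)) / n \<le> f w + g \<bullet> (y - w) + L / 2 * (norm (y - w))\<^sup>2
      + \<theta> * (g \<bullet> \<delta>) + L * (\<theta> * ((y - w) \<bullet> \<delta>)) + L / 2 * n * \<theta>\<^sup>2 * (norm \<delta>)\<^sup>2"
    using n1 by (simp add: divide_le_eq mult.commute)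
  \<comment> \<open>Young's inequality, with the ratio for which its share of the squared norm of
    \<open>\<delta>\<close> equals the curvature term in \<open>smooth\<close>; together they
    contribute \<open>L * n * \<theta>\<^sup>2\<close>.\<close>
  have "L * (\<theta> * ((y - w) \<bullet> \<delta>)) \<le> L * ((norm (y - w))\<^sup>2 / (2 * n) + n * \<theta>\<^sup>2 * (norm \<delta>)\<^sup>2 / 2)"
  proof (rule mult_left_mono[OF _ L0])
    have "0 \<le> (norm ((y - w) - (n * \<theta>) *\<^sub>R \<delta>))\<^sup>2" by simp
    also have "\<dots> = (norm (y - w))\<^sup>2 - 2 * n * (\<theta> * ((y - w) \<bullet> \<delta>)) + n\<^sup>2 * (\<theta>\<^sup>2 * (norm \<delta>)\<^sup>2)"
      unfolding power2_norm_eq_inner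
      by (simp add: inner_diff_left inner_diff_right inner_commute power2_eq_square algebra_simps)
    finally show "\<theta> * ((y - w) \<bullet> \<delta>) \<le> (norm (y - w))\<^sup>2 / (2 * n) + n * \<theta>\<^sup>2 * (norm \<delta>)\<^sup>2 / 2"
      using n1 by (simp add: field_simps power2_eq_square)
  qed
  then have young: "L * (\<theta> * ((y - w) \<bullet> \<delta>))
      \<le> L / 2 * (1 / n) * (norm (y - w))\<^sup>2 + L / 2 * n * \<theta>\<^sup>2 * (norm \<delta>)\<^sup>2"
    by (simp add: algebra_simps)
  \<comment> \<open>Both tangent inequalities are taken at \<open>w\<close>, the point at which the
    gradient is evaluated, with weights \<open>1 - \<theta>\<close> and \<open>\<theta>\<close>. The
    remainder along \<open>z - xs\<close> is cancelled by \<open>prox\<close>.\<close>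
  have tangent: "f w + g \<bullet> (y - w) \<le> (1 - \<theta>) * f x + \<theta> * f xs + \<theta> * (g \<bullet> (z - xs))"
  proof -
    have "(1 - \<theta>) * (f w + g \<bullet> (x - w)) \<le> (1 - \<theta>) * f x"
      using convex_above_tangent[OF f(1,2), of w x] \<theta> by (intro mult_left_mono) (auto simp: g_def)
    moreover have "\<theta> * (f w + g \<bullet> (xs - w)) \<le> \<theta> * f xs"
      using convex_above_tangent[OF f(1,2), of w xs] \<theta> by (intro mult_left_mono) (auto simp: g_def)
    moreover have "g \<bullet> (y - w)
        = (1 - \<theta>) * (g \<bullet> (x - w)) + \<theta> * (g \<bullet> (xs - w)) + \<theta> * (g \<bullet> (z - xs))"
      by (simp add: y_def inner_add_right inner_diff_right algebra_simps)
    ultimately show ?thesis by (simp add: algebra_simps)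
  qed
  have Z_nth: "Z i $ l = (if l = i then z $ l + \<delta> $ l else z $ l)" for i l
    by (simp add: Z_def axis_def)
  \<comment> \<open>\<open>G\<close> is general because the identity serves both the values of
    \<open>H\<close> and the squared distances to \<open>xs\<close>.\<close>
  have update: "(\<Sum>l\<in>UNIV. G l (Z i $ l)) = (\<Sum>l\<in>UNIV. G l (z $ l)) + (G i (z $ i + \<delta> $ i) - G i (z $ i))"
    for i and G :: "'n \<Rightarrow> real \<Rightarrow> real"
  proof -
    have "(\<Sum>l\<in>UNIV. G l (Z i $ l)) - (\<Sum>l\<in>UNIV. G l (z $ l))
        = (\<Sum>l\<in>UNIV. if l = i then G i (z $ i + \<delta> $ i) - G i (z $ i) else 0)"
      unfolding sum_subtractf[symmetric] by (rule sum.cong) (auto simp: Z_nth)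
    then show ?thesis by simp
  qed
  have total: "(\<Sum>i\<in>UNIV. \<Sum>l\<in>UNIV. G l (Z i $ l))
      = (n - 1) * (\<Sum>l\<in>UNIV. G l (z $ l)) + (\<Sum>i\<in>UNIV. G i (z $ i + \<delta> $ i))"
    for G :: "'n \<Rightarrow> real \<Rightarrow> real"
    unfolding update by (simp add: sum.distrib sum_subtractf n_def algebra_simps)
  \<comment> \<open>On average the unchanged coordinates cancel against the negative term of
    \<open>\<eta>'\<close>, which leaves only the values of \<open>H\<close> at
    \<open>z + \<delta>\<close>.\<close>
  have "(\<Sum>i\<in>UNIV. \<eta>' i) = n * ((1 - \<theta>) * \<eta> - (n - 1) * \<theta> * (\<Sum>l\<in>UNIV. H l (z $ l)))
      + n * \<theta> * (\<Sum>i\<in>UNIV. \<Sum>l\<in>UNIV. H l (Z i $ l))"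
    by (simp add: \<eta>'_def sum.distrib sum_subtractf sum_distrib_left[symmetric] n_def algebra_simps)
  then have "(\<Sum>i\<in>UNIV. \<eta>' i) = n * ((1 - \<theta>) * \<eta> + \<theta> * (\<Sum>i\<in>UNIV. H i (z $ i + \<delta> $ i)))"
    unfolding total by (simp add: algebra_simps)
  then have hull: "(\<Sum>i\<in>UNIV. \<eta>' i) / n = (1 - \<theta>) * \<eta> + \<theta> * (\<Sum>i\<in>UNIV. H i (z $ i + \<delta> $ i))"
    using n1 by simp
  have dist: "(\<Sum>i\<in>UNIV. (norm (Z i - xs))\<^sup>2)
      = (n - 1) * (norm (z - xs))\<^sup>2 + (norm (z + \<delta> - xs))\<^sup>2"
    using total[of "\<lambda>l t. (t - xs $ l)\<^sup>2"] by (simp add: sq)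
  have "(\<Sum>i\<in>UNIV. H i (z $ i + \<delta> $ i) + g $ i * (z $ i + \<delta> $ i) + q * (\<delta> $ i)\<^sup>2
          + (q + \<mu> / 2) * (z $ i + \<delta> $ i - xs $ i)\<^sup>2)
      \<le> (\<Sum>i\<in>UNIV. H i (xs $ i) + g $ i * xs $ i + q * (xs $ i - z $ i)\<^sup>2)"
    using three_point by (intro sum_mono) (simp add: q_def g_def)
  then have "(\<Sum>i\<in>UNIV. H i (z $ i + \<delta> $ i)) + g \<bullet> (z + \<delta>) + q * (norm \<delta>)\<^sup>2
      + (q + \<mu> / 2) * (norm (z + \<delta> - xs))\<^sup>2
      \<le> (\<Sum>i\<in>UNIV. H i (xs $ i)) + g \<bullet> xs + q * (norm (z - xs))\<^sup>2"
    by (simp add: sum.distrib sum_distrib_left[symmetric] inner_vec_def sq power2_commute)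
  from mult_left_mono[OF this, of \<theta>] \<theta>
  have prox: "\<theta> * (\<Sum>i\<in>UNIV. H i (z $ i + \<delta> $ i)) + \<theta> * (g \<bullet> (z - xs)) + \<theta> * (g \<bullet> \<delta>)
      + n * \<theta>\<^sup>2 / (2 * \<gamma>) * (norm \<delta>)\<^sup>2 + A * (norm (z + \<delta> - xs))\<^sup>2
      \<le> \<theta> * (\<Sum>i\<in>UNIV. H i (xs $ i)) + n * \<theta>\<^sup>2 / (2 * \<gamma>) * (norm (z - xs))\<^sup>2"
    by (simp add: q_def A_def inner_add_right inner_diff_right algebra_simps power2_eq_square)
  have "(\<Sum>i\<in>UNIV. f (X i) + \<eta>' i) / n = (\<Sum>i\<in>UNIV. f (X i)) / n + (\<Sum>i\<in>UNIV. \<eta>' i) / n"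
    by (simp add: sum.distrib add_divide_distrib)
  then have "(\<Sum>i\<in>UNIV. f (X i) + \<eta>' i) / n - v + A * (\<Sum>i\<in>UNIV. (norm (Z i - xs))\<^sup>2)
      \<le> (1 - \<theta>) * f x + \<theta> * f xs + (1 - \<theta>) * \<eta> + \<theta> * (\<Sum>i\<in>UNIV. H i (xs $ i)) - v
      + A * ((n - 1) * (norm (z - xs))\<^sup>2) + n * \<theta>\<^sup>2 / (2 * \<gamma>) * (norm (z - xs))\<^sup>2
      + (L / 2 * (norm (y - w))\<^sup>2 + L / 2 * (1 / n) * (norm (y - w))\<^sup>2)
      + (L / 2 * n * \<theta>\<^sup>2 * (norm \<delta>)\<^sup>2 + L / 2 * n * \<theta>\<^sup>2 * (norm \<delta>)\<^sup>2
      - n * \<theta>\<^sup>2 / (2 * \<gamma>) * (norm \<delta>)\<^sup>2)"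
    unfolding hull dist distrib_left using smooth young tangent prox by linarith
  also have "\<dots> = (1 - \<theta>) * (f x + \<eta> - v) + ((n - 1) * A + n * \<theta>\<^sup>2 / (2 * \<gamma>)) * (norm (z - xs))\<^sup>2
      + L / 2 * (1 + 1 / n) * (norm (y - w))\<^sup>2 - n * \<theta>\<^sup>2 * (1 / (2 * \<gamma>) - L) * (norm \<delta>)\<^sup>2"
    by (simp add: v_def algebra_simps)
  finally show ?thesis .
qed

section \<open>Averages over coordinate histories\<close>

text \<open>All histories of length \<open>k\<close> are equally likely, so this finite average is
  the expectation of a function of the first \<open>k\<close> coordinates.\<close>

definition history_mean :: "nat \<Rightarrow> ('n::finite list \<Rightarrow> real) \<Rightarrow> real" where
  "history_mean k g = (\<Sum>\<sigma> | length \<sigma> = k. g \<sigma>) / real CARD('n) ^ k"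

lemma finite_histories [simp]: "finite {\<sigma> :: 'n::finite list. length \<sigma> = k}"
  using finite_lists_length_eq[of "UNIV :: 'n set" k] by simp

text \<open>The tower property: average over the newest coordinate with the past fixed, then over
  the past. Histories grow at the end of the list.\<close>

lemma history_mean_Suc:
  fixes g :: "'n::finite list \<Rightarrow> real"
  shows "history_mean (Suc k) g = history_mean k (\<lambda>\<sigma>. (\<Sum>i\<in>UNIV. g (\<sigma> @ [i])) / real CARD('n))"
proof -
  have "(\<Sum>\<sigma> | length \<sigma> = Suc k. g \<sigma>) = (\<Sum>(\<sigma>, i)\<in>{\<sigma>. length \<sigma> = k} \<times> UNIV. g (\<sigma> @ [i]))"
    by (rule sum.reindex_bij_witness[of _ "\<lambda>(\<sigma>, i). \<sigma> @ [i]" "\<lambda>\<sigma>. (butlast \<sigma>, last \<sigma>)"])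
      (auto, metis append_butlast_last_id length_0_conv nat.distinct(1),
        metis append_butlast_last_id length_0_conv nat.distinct(1))
  then show ?thesis
    by (simp add: history_mean_def sum.cartesian_product[symmetric] sum_divide_distrib[symmetric])
qed

lemma history_mean_0 [simp]: "history_mean 0 g = g []"
  by (simp add: history_mean_def)

lemma history_mean_mono:
  "(\<And>\<sigma>. length \<sigma> = k \<Longrightarrow> g \<sigma> \<le> g' \<sigma>) \<Longrightarrow> history_mean k g \<le> history_mean k g'"
  unfolding history_mean_def by (intro divide_right_mono sum_mono) auto

lemma history_mean_cong:
  "(\<And>\<sigma>. length \<sigma> = k \<Longrightarrow> g \<sigma> = g' \<sigma>) \<Longrightarrow> history_mean k g = history_mean k g'"
  by (simp add: history_mean_def)

lemma history_mean_add: "history_mean k (\<lambda>\<sigma>. g \<sigma> + g' \<sigma>) = history_mean k g + history_mean k g'"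
  by (simp add: history_mean_def sum.distrib add_divide_distrib)

lemma history_mean_cmult: "history_mean k (\<lambda>\<sigma>. a * g \<sigma>) = a * history_mean k g"
  by (simp add: history_mean_def sum_distrib_left)

lemma history_mean_diff: "history_mean k (\<lambda>\<sigma>. g \<sigma> - g' \<sigma>) = history_mean k g - history_mean k g'"
  by (simp add: history_mean_def sum_subtractf diff_divide_distrib)

lemma history_mean_const [simp]: "history_mean k (\<lambda>_ :: 'n::finite list. a) = a"
proof -
  have "card {\<sigma> :: 'n list. length \<sigma> = k} = CARD('n) ^ k"
    using card_lists_length_eq[of "UNIV :: 'n set" k] by simp
  then show ?thesis by (simp add: history_mean_def)
qed

lemma history_mean_sum:
  "history_mean k (\<lambda>\<sigma>. \<Sum>m\<in>I. g m \<sigma>) = (\<Sum>m\<in>I. history_mean k (g m))"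
  unfolding history_mean_def by (subst sum.swap) (simp add: sum_divide_distrib)

lemma history_mean_nonneg: "(\<And>\<sigma>. length \<sigma> = k \<Longrightarrow> 0 \<le> g \<sigma>) \<Longrightarrow> 0 \<le> history_mean k g"
  using history_mean_mono[of k "\<lambda>_. 0" g] by simp

lemma history_mean_prefix:
  assumes "\<And>\<sigma> i. m \<le> length \<sigma> \<Longrightarrow> g (\<sigma> @ [i]) = g \<sigma>" and "m \<le> k"
  shows "history_mean k g = history_mean m g"
  using assms(2)
proof (induction k rule: dec_induct)
  case (step k)
  have "history_mean (Suc k) g = history_mean k g"
    unfolding history_mean_Suc using step by (intro history_mean_cong) (simp add: assms(1))
  with step show ?case by simp
qed simp

section \<open>Iterates as convex combinations\<close>

text \<open>The coefficient of \<open>z\<^sup>l\<close> in \<open>x\<^sup>k\<close>.\<close>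

definition hull_weight :: "real \<Rightarrow> (nat \<Rightarrow> real) \<Rightarrow> nat \<Rightarrow> nat \<Rightarrow> real" where
  "hull_weight n \<theta> = rec_nat (\<lambda>l. if l = 0 then 1 else 0)
     (\<lambda>k e l. (1 - \<theta> k) * e l + (if l = Suc k then n * \<theta> k else 0) - (if l = k then (n - 1) * \<theta> k else 0))"

lemma hull_weight_0: "hull_weight n \<theta> 0 l = (if l = 0 then 1 else 0)"
  by (simp add: hull_weight_def)

lemma hull_weight_Suc:
  "hull_weight n \<theta> (Suc k) l = (1 - \<theta> k) * hull_weight n \<theta> k l
     + (if l = Suc k then n * \<theta> k else 0) - (if l = k then (n - 1) * \<theta> k else 0)"
  by (simp add: hull_weight_def)

lemma hull_weight_beyond: "k < l \<Longrightarrow> hull_weight n \<theta> k l = 0"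
  by (induction k) (auto simp: hull_weight_0 hull_weight_Suc)

text \<open>The recursion of \<open>x\<close>, for an arbitrary sequence in place of
  \<open>z\<close>: with the constant 1 it gives the total weight, with the values of
  \<open>h\<close> at the \<open>z\<close>-iterates it gives the recursion of
  \<open>hbar\<close>.\<close>

lemma sum_hull_weight_Suc:
  fixes g :: "nat \<Rightarrow> 'b::real_vector"
  shows "(\<Sum>l\<le>Suc k. hull_weight n \<theta> (Suc k) l *\<^sub>R g l)
    = (1 - \<theta> k) *\<^sub>R (\<Sum>l\<le>k. hull_weight n \<theta> k l *\<^sub>R g l)
      + (n * \<theta> k) *\<^sub>R g (Suc k) - ((n - 1) * \<theta> k) *\<^sub>R g k"
proof -
  have "(\<Sum>l\<le>k. hull_weight n \<theta> (Suc k) l *\<^sub>R g l)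
      = (\<Sum>l\<le>k. (1 - \<theta> k) *\<^sub>R (hull_weight n \<theta> k l *\<^sub>R g l)
          - (if l = k then ((n - 1) * \<theta> k) *\<^sub>R g k else 0))"
    by (intro sum.cong) (auto simp: hull_weight_Suc algebra_simps)
  also have "\<dots> = (1 - \<theta> k) *\<^sub>R (\<Sum>l\<le>k. hull_weight n \<theta> k l *\<^sub>R g l) - ((n - 1) * \<theta> k) *\<^sub>R g k"
    by (simp add: sum_subtractf scaleR_sum_right)
  finally show ?thesis by (simp add: hull_weight_Suc hull_weight_beyond)
qed

lemma sum_hull_weight: "(\<Sum>l\<le>k. hull_weight n \<theta> k l) = 1"
proof (induction k)
  case (Suc k)
  have "(\<Sum>l\<le>Suc k. hull_weight n \<theta> (Suc k) l)
      = (1 - \<theta> k) * (\<Sum>l\<le>k. hull_weight n \<theta> k l) + n * \<theta> k - (n - 1) * \<theta> k"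
    using sum_hull_weight_Suc[where g = "\<lambda>_. 1 :: real" and n = n and \<theta> = \<theta> and k = k]
    by (simp only: real_scaleR_def mult_1_right)
  with Suc show ?case by (simp only:) (simp add: algebra_simps)
qed (simp add: hull_weight_0)

text \<open>Only the weight at \<open>l = k\<close> is ever reduced. For \<open>k > 0\<close> it was
  just created as \<open>n * \<theta> (k - 1)\<close>, and what remains splits into two terms that
  are nonnegative by monotonicity of \<open>\<theta>\<close> and by
  \<open>n * \<theta> m \<le> 1\<close>.\<close>

lemma hull_weight_nonneg:
  assumes \<theta>: "\<And>m. 0 < \<theta> m" "\<And>m. \<theta> m \<le> 1 / n" "\<And>m. \<theta> (Suc m) \<le> \<theta> m" and n: "1 \<le> n"
  shows "0 \<le> hull_weight n \<theta> k l"
proof -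
  have \<theta>n: "n * \<theta> m \<le> 1" for m using \<theta>(2)[of m] n by (simp add: field_simps)
  have \<theta>1: "\<theta> m \<le> 1" for m
    using \<theta>n[of m] mult_right_mono[OF n less_imp_le[OF \<theta>(1)[of m]]] by simp
  show ?thesis
  proof (induction k arbitrary: l)
    case (Suc k)
    show ?case
    proof (cases "l = k")
      case True
      have "0 \<le> (1 - \<theta> k) * hull_weight n \<theta> k k - (n - 1) * \<theta> k"
      proof (cases k)
        case 0
        with \<theta>n[of 0] show ?thesis by (simp add: hull_weight_0 algebra_simps)
      next
        case (Suc m)
        have "0 \<le> n * (\<theta> m - \<theta> k) + \<theta> k * (1 - n * \<theta> m)"
          using \<theta>(3)[of m] \<theta>(1)[of k] \<theta>n[of m] n Suc by simp
        also have "\<dots> = (1 - \<theta> k) * (n * \<theta> m) - (n - 1) * \<theta> k"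
          by (simp add: algebra_simps)
        also have "n * \<theta> m = hull_weight n \<theta> k k"
          by (simp add: Suc hull_weight_Suc hull_weight_beyond)
        finally show ?thesis .
      qed
      with True show ?thesis by (simp add: hull_weight_Suc)
    next
      case False
      with Suc[of l] \<theta>1[of k] \<theta>(1)[of k] n show ?thesis by (simp add: hull_weight_Suc)
    qed
  qed (simp add: hull_weight_0)
qed

text \<open>The list \<open>\<sigma>\<close> is the history of coordinates chosen so far, and \<open>X m \<sigma>\<close>, \<open>Z m \<sigma>\<close> are meaningful
  only for \<open>m \<le> length \<sigma>\<close>. The functions \<open>H i\<close> are the finite parts of the \<open>h\<^sub>i\<close>, with domains \<open>D i\<close>.\<close>

locale aascd_tree =
  fixes f :: "real ^ 'n::finite \<Rightarrow> real" and H :: "'n \<Rightarrow> real \<Rightarrow> real" and D :: "'n \<Rightarrow> real set"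
    and \<theta> :: "nat \<Rightarrow> real" and L \<gamma> \<mu> n :: real and j :: "nat \<Rightarrow> nat" and \<tau> :: nat
    and xs :: "real ^ 'n" and X Z :: "nat \<Rightarrow> 'n list \<Rightarrow> real ^ 'n"
  assumes n_def: "n = real CARD('n)"
    and f: "convex_on UNIV f" "\<And>u. f differentiable (at u)" "coord_lipschitz f L"
    and H_convex: "\<And>i. convex_on (D i) (H i)"
    and D_0: "\<And>i. 0 \<in> D i"
    and minimizer: "\<And>u. (\<And>i. u $ i \<in> D i) \<Longrightarrow>
      f xs + (\<Sum>i\<in>UNIV. H i (xs $ i)) \<le> f u + (\<Sum>i\<in>UNIV. H i (u $ i))"
    and \<gamma>: "0 < \<gamma>"
    and \<theta>: "\<And>m. 0 < \<theta> m" "\<And>m. \<theta> m \<le> 1 / n" "\<And>m. \<theta> (Suc m) \<le> \<theta> m"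
    and delay: "\<And>k. k - \<tau> \<le> j k" "\<And>k. j k \<le> k"
    and init: "\<And>\<sigma>. X 0 \<sigma> = 0" "\<And>\<sigma>. Z 0 \<sigma> = 0"
    and prefix: "\<And>m \<sigma> i. m \<le> length \<sigma> \<Longrightarrow> X m (\<sigma> @ [i]) = X m \<sigma>"
      "\<And>m \<sigma> i. m \<le> length \<sigma> \<Longrightarrow> Z m (\<sigma> @ [i]) = Z m \<sigma>"
    and X_Suc: "\<And>m \<sigma>. m < length \<sigma> \<Longrightarrow> X (Suc m) \<sigma>
      = (1 - \<theta> m) *\<^sub>R X m \<sigma> + (n * \<theta> m) *\<^sub>R Z (Suc m) \<sigma> - ((n - 1) * \<theta> m) *\<^sub>R Z m \<sigma>"
    and prox: "\<And>k \<sigma> i. length \<sigma> = k \<Longrightarrow> \<exists>d. Z (Suc k) (\<sigma> @ [i]) = Z k \<sigma> + d *\<^sub>R axis i 1 \<and>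
      Z k \<sigma> $ i + d \<in> D i \<and>
      (let g = gradient f (compensated \<theta> j (\<lambda>m. X m \<sigma>) (\<lambda>m. Z m \<sigma>) k) $ i in
        H i (Z k \<sigma> $ i + d) + g * (Z k \<sigma> $ i + d) + n * \<theta> k / (2 * \<gamma>) * d\<^sup>2
          + (n * \<theta> k / (2 * \<gamma>) + \<mu> / 2) * (Z k \<sigma> $ i + d - xs $ i)\<^sup>2
        \<le> H i (xs $ i) + g * xs $ i + n * \<theta> k / (2 * \<gamma>) * (xs $ i - Z k \<sigma> $ i)\<^sup>2)"
begin

abbreviation hsum :: "real ^ 'n \<Rightarrow> real" where
  "hsum u \<equiv> (\<Sum>i\<in>UNIV. H i (u $ i))"

abbreviation opt :: real where
  "opt \<equiv> f xs + hsum xs"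

abbreviation hbar :: "nat \<Rightarrow> 'n list \<Rightarrow> real" where
  "hbar k \<sigma> \<equiv> (\<Sum>l\<le>k. hull_weight n \<theta> k l *\<^sub>R hsum (Z l \<sigma>))"

text \<open>The coefficient of the squared distance in the proximal inequality, multiplied by
  \<open>\<theta> k\<close>.\<close>

abbreviation A :: "nat \<Rightarrow> real" where
  "A k \<equiv> n * (\<theta> k)\<^sup>2 / (2 * \<gamma>) + \<theta> k * \<mu> / 2"

abbreviation gap :: "nat \<Rightarrow> 'n list \<Rightarrow> real" where
  "gap k \<sigma> \<equiv> norm (extrapolation \<theta> (\<lambda>m. X m \<sigma>) (\<lambda>m. Z m \<sigma>) k
                    - compensated \<theta> j (\<lambda>m. X m \<sigma>) (\<lambda>m. Z m \<sigma>) k)"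

abbreviation move :: "nat \<Rightarrow> real" where
  "move k \<equiv> history_mean (Suc k) (\<lambda>\<sigma>. (norm (Z (Suc k) \<sigma> - Z k \<sigma>))\<^sup>2)"

lemma n1: "1 \<le> n" by (simp add: n_def Suc_leI)

lemma \<theta>_le_1: "\<theta> m \<le> 1"
proof -
  have "1 / n \<le> 1" using n1 by simp
  with \<theta>(2)[of m] show ?thesis by (rule order_trans)
qed

lemma Z_in_D: "m \<le> length \<sigma> \<Longrightarrow> Z m \<sigma> $ i \<in> D i"
proof (induction \<sigma> arbitrary: m i rule: rev_induct)
  case Nil
  then show ?case by (simp add: init D_0)
next
  case (snoc l \<sigma>)
  show ?case
  proof (cases "m \<le> length \<sigma>")
    case True
    with snoc.IH show ?thesis by (simp add: prefix)
  next
    case False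
    with snoc.prems have m: "m = Suc (length \<sigma>)" by simp
    obtain d where "Z m (\<sigma> @ [l]) = Z (length \<sigma>) \<sigma> + d *\<^sub>R axis l 1"
      "Z (length \<sigma>) \<sigma> $ l + d \<in> D l"
      using prox[of \<sigma> "length \<sigma>" l] by (auto simp: m)
    with snoc.IH[of "length \<sigma>" i] show ?thesis by (auto simp: axis_def)
  qed
qed

lemma X_combination:
  "m \<le> length \<sigma> \<Longrightarrow> X m \<sigma> = (\<Sum>l\<le>m. hull_weight n \<theta> m l *\<^sub>R Z l \<sigma>)"
proof (induction m)
  case 0
  then show ?case by (simp add: init)
next
  case (Suc m)
  then show ?case by (simp only: sum_hull_weight_Suc X_Suc[of m \<sigma>] Suc_le_lessD Suc_leD)
qed

lemma X_in_D:
  assumes "m \<le> length \<sigma>"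
  shows "X m \<sigma> $ i \<in> D i"
proof -
  have "X m \<sigma> $ i = (\<Sum>l\<le>m. hull_weight n \<theta> m l *\<^sub>R (Z l \<sigma> $ i))"
    unfolding X_combination[OF assms] by simp
  also have "\<dots> \<in> D i"
    using assms by (intro convex_sum convex_on_imp_convex[OF H_convex] sum_hull_weight
        hull_weight_nonneg \<theta> n1 Z_in_D) auto
  finally show ?thesis .
qed

lemma hsum_X_le_hbar:
  assumes "m \<le> length \<sigma>"
  shows "hsum (X m \<sigma>) \<le> hbar m \<sigma>"
proof -
  have "hsum (X m \<sigma>) \<le> (\<Sum>i\<in>UNIV. \<Sum>l\<le>m. hull_weight n \<theta> m l * H i (Z l \<sigma> $ i))"
  proof (rule sum_mono)
    fix i
    have "H i (\<Sum>l\<le>m. hull_weight n \<theta> m l *\<^sub>R (Z l \<sigma> $ i))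
        \<le> (\<Sum>l\<le>m. hull_weight n \<theta> m l * H i (Z l \<sigma> $ i))"
      using assms by (intro convex_on_sum[OF _ _ H_convex] sum_hull_weight hull_weight_nonneg \<theta> n1 Z_in_D) auto
    then show "H i (X m \<sigma> $ i) \<le> (\<Sum>l\<le>m. hull_weight n \<theta> m l * H i (Z l \<sigma> $ i))"
      unfolding X_combination[OF assms] by simp
  qed
  also have "\<dots> = hbar m \<sigma>"
    by (subst sum.swap) (simp add: sum_distrib_left)
  finally show ?thesis .
qed

lemma opt_le_hbar: "length \<sigma> = k \<Longrightarrow> opt \<le> f (X k \<sigma>) + hbar k \<sigma>"
  using minimizer[of "X k \<sigma>"] X_in_D[of k \<sigma>] hsum_X_le_hbar[of k \<sigma>] by fastforce

text \<open>The one-step estimate is averaged over the next coordinate, then over the past, and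
  scaled by \<open>w\<close>. Passing to \<open>w'\<close> and \<open>b\<close> needs nonnegative
  factors; for the objective this is \<open>opt_le_hbar\<close>.\<close>

lemma mean_step:
  assumes W: "0 \<le> w" "w * (1 - \<theta> k) \<le> w'" "w * ((n - 1) * A k + n * (\<theta> k)\<^sup>2 / (2 * \<gamma>)) \<le> b"
  shows "w * (history_mean (Suc k) (\<lambda>\<sigma>. f (X (Suc k) \<sigma>) + hbar (Suc k) \<sigma>) - opt)
      + w * (n * A k) * history_mean (Suc k) (\<lambda>\<sigma>. (norm (Z (Suc k) \<sigma> - xs))\<^sup>2)
    \<le> w' * (history_mean k (\<lambda>\<sigma>. f (X k \<sigma>) + hbar k \<sigma>) - opt)
      + b * history_mean k (\<lambda>\<sigma>. (norm (Z k \<sigma> - xs))\<^sup>2)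
      + w * (L / 2 * (1 + 1 / n) * history_mean k (\<lambda>\<sigma>. (gap k \<sigma>)\<^sup>2)
             - n\<^sup>2 * (\<theta> k)\<^sup>2 * (1 / (2 * \<gamma>) - L) * move k)"
proof -
  let ?\<Phi> = "\<lambda>k \<sigma>. f (X k \<sigma>) + hbar k \<sigma>"
  let ?c = "(n - 1) * A k + n * (\<theta> k)\<^sup>2 / (2 * \<gamma>)"
  have pointwise: "(\<Sum>i\<in>UNIV. ?\<Phi> (Suc k) (\<sigma> @ [i])) / n - opt
        + n * A k * ((\<Sum>i\<in>UNIV. (norm (Z (Suc k) (\<sigma> @ [i]) - xs))\<^sup>2) / n)
      \<le> (1 - \<theta> k) * (?\<Phi> k \<sigma> - opt) + ?c * (norm (Z k \<sigma> - xs))\<^sup>2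
        + L / 2 * (1 + 1 / n) * (gap k \<sigma>)\<^sup>2
        - n\<^sup>2 * (\<theta> k)\<^sup>2 * (1 / (2 * \<gamma>) - L)
          * ((\<Sum>i\<in>UNIV. (norm (Z (Suc k) (\<sigma> @ [i]) - Z k (\<sigma> @ [i])))\<^sup>2) / n)"
    if \<sigma>: "length \<sigma> = k" for \<sigma>
  proof -
    define w where "w = compensated \<theta> j (\<lambda>m. X m \<sigma>) (\<lambda>m. Z m \<sigma>) k"
    define y where "y = extrapolation \<theta> (\<lambda>m. X m \<sigma>) (\<lambda>m. Z m \<sigma>) k"
    have "\<exists>\<delta>. \<forall>i. Z (Suc k) (\<sigma> @ [i]) = Z k \<sigma> + \<delta> i *\<^sub>R axis i 1 \<and>
        H i (Z k \<sigma> $ i + \<delta> i) + gradient f w $ i * (Z k \<sigma> $ i + \<delta> i) + n * \<theta> k / (2 * \<gamma>) * (\<delta> i)\<^sup>2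
          + (n * \<theta> k / (2 * \<gamma>) + \<mu> / 2) * (Z k \<sigma> $ i + \<delta> i - xs $ i)\<^sup>2
        \<le> H i (xs $ i) + gradient f w $ i * xs $ i + n * \<theta> k / (2 * \<gamma>) * (xs $ i - Z k \<sigma> $ i)\<^sup>2"
      by (rule choice) (use prox[OF \<sigma>] in \<open>unfold Let_def w_def, blast\<close>)
    then obtain \<delta>' where \<delta>': "Z (Suc k) (\<sigma> @ [i]) = Z k \<sigma> + \<delta>' i *\<^sub>R axis i 1"
        "H i (Z k \<sigma> $ i + \<delta>' i) + gradient f w $ i * (Z k \<sigma> $ i + \<delta>' i) + n * \<theta> k / (2 * \<gamma>) * (\<delta>' i)\<^sup>2
          + (n * \<theta> k / (2 * \<gamma>) + \<mu> / 2) * (Z k \<sigma> $ i + \<delta>' i - xs $ i)\<^sup>2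
        \<le> H i (xs $ i) + gradient f w $ i * xs $ i + n * \<theta> k / (2 * \<gamma>) * (xs $ i - Z k \<sigma> $ i)\<^sup>2" for i
      by blast
    define \<delta> :: "real ^ 'n" where "\<delta> = (\<chi> i. \<delta>' i)"
    have Z_Suc: "Z (Suc k) (\<sigma> @ [i]) = Z k \<sigma> + (\<delta> $ i) *\<^sub>R axis i 1" for i
      using \<delta>'(1) by (simp add: \<delta>_def)
    have X_Suc': "X (Suc k) (\<sigma> @ [i]) = y + (n * \<theta> k * \<delta> $ i) *\<^sub>R axis i 1" for i
      using X_Suc[of k "\<sigma> @ [i]"] \<sigma>
      by (simp add: prefix Z_Suc y_def extrapolation_def algebra_simps)
    have hbar_Suc: "hbar (Suc k) (\<sigma> @ [i]) = (1 - \<theta> k) * hbar k \<sigma>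
        + n * \<theta> k * hsum (Z k \<sigma> + (\<delta> $ i) *\<^sub>R axis i 1) - (n - 1) * \<theta> k * hsum (Z k \<sigma>)" for i
      unfolding sum_hull_weight_Suc Z_Suc using \<sigma> by (simp add: prefix)
    \<comment> \<open>Only one coordinate moves, so the conditional mean of the squared move is the
      squared norm of \<open>\<delta>\<close> divided by \<open>n\<close>; hence
      \<open>n\<^sup>2\<close> in front of \<open>move\<close>.\<close>
    have move: "(\<Sum>i\<in>UNIV. (norm (Z (Suc k) (\<sigma> @ [i]) - Z k (\<sigma> @ [i])))\<^sup>2) = (norm \<delta>)\<^sup>2"
    proof -
      have "(norm \<delta>)\<^sup>2 = (\<Sum>i\<in>UNIV. (\<delta> $ i)\<^sup>2)"
        unfolding power2_norm_eq_inner by (simp add: inner_vec_def power2_eq_square)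
      then show ?thesis using \<sigma> by (simp add: Z_Suc prefix norm_axis_1)
    qed
    have "(\<Sum>i\<in>UNIV. ?\<Phi> (Suc k) (\<sigma> @ [i])) / n - opt
          + A k * (\<Sum>i\<in>UNIV. (norm (Z (Suc k) (\<sigma> @ [i]) - xs))\<^sup>2)
        \<le> (1 - \<theta> k) * (?\<Phi> k \<sigma> - opt) + ?c * (norm (Z k \<sigma> - xs))\<^sup>2
          + L / 2 * (1 + 1 / n) * (gap k \<sigma>)\<^sup>2 - n * (\<theta> k)\<^sup>2 * (1 / (2 * \<gamma>) - L) * (norm \<delta>)\<^sup>2"
      unfolding X_Suc' hbar_Suc Z_Suc w_def[symmetric] y_def extrapolation_def
      by (rule coordinate_step_inequality[where H = H and \<delta> = \<delta> and w = w and \<theta> = "\<theta> k",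
            folded n_def, OF f \<theta>(1) \<theta>_le_1]) (use \<delta>'(2) in \<open>simp add: \<delta>_def\<close>)
    then show ?thesis
      unfolding move using n1 by (simp add: power2_eq_square)
  qed
  have "history_mean (Suc k) (?\<Phi> (Suc k)) - opt
      + n * A k * history_mean (Suc k) (\<lambda>\<sigma>. (norm (Z (Suc k) \<sigma> - xs))\<^sup>2)
    = history_mean k (\<lambda>\<sigma>. (\<Sum>i\<in>UNIV. ?\<Phi> (Suc k) (\<sigma> @ [i])) / n - opt
        + n * A k * ((\<Sum>i\<in>UNIV. (norm (Z (Suc k) (\<sigma> @ [i]) - xs))\<^sup>2) / n))"
    by (simp only: history_mean_Suc history_mean_add history_mean_diff history_mean_cmult
        history_mean_const n_def[symmetric] sum.distrib add_divide_distrib)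
  also have "\<dots> \<le> history_mean k (\<lambda>\<sigma>. (1 - \<theta> k) * (?\<Phi> k \<sigma> - opt) + ?c * (norm (Z k \<sigma> - xs))\<^sup>2
        + L / 2 * (1 + 1 / n) * (gap k \<sigma>)\<^sup>2
        - n\<^sup>2 * (\<theta> k)\<^sup>2 * (1 / (2 * \<gamma>) - L)
          * ((\<Sum>i\<in>UNIV. (norm (Z (Suc k) (\<sigma> @ [i]) - Z k (\<sigma> @ [i])))\<^sup>2) / n))"
    by (rule history_mean_mono) (rule pointwise)
  also have "\<dots> = (1 - \<theta> k) * (history_mean k (?\<Phi> k) - opt)
      + ?c * history_mean k (\<lambda>\<sigma>. (norm (Z k \<sigma> - xs))\<^sup>2)
      + L / 2 * (1 + 1 / n) * history_mean k (\<lambda>\<sigma>. (gap k \<sigma>)\<^sup>2)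
      - n\<^sup>2 * (\<theta> k)\<^sup>2 * (1 / (2 * \<gamma>) - L) * move k"
    by (simp only: history_mean_Suc history_mean_add history_mean_diff history_mean_cmult
        history_mean_const n_def[symmetric])
  finally have "w * (history_mean (Suc k) (?\<Phi> (Suc k)) - opt
      + n * A k * history_mean (Suc k) (\<lambda>\<sigma>. (norm (Z (Suc k) \<sigma> - xs))\<^sup>2)) \<le> w * \<dots>"
    using W(1) by (rule mult_left_mono)
  moreover have "w * (1 - \<theta> k) * (history_mean k (?\<Phi> k) - opt) \<le> w' * (history_mean k (?\<Phi> k) - opt)"
    using history_mean_mono[of k "\<lambda>_. opt" "?\<Phi> k", OF opt_le_hbar] W(2) by (intro mult_right_mono) auto
  moreover have "w * ?c * history_mean k (\<lambda>\<sigma>. (norm (Z k \<sigma> - xs))\<^sup>2)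
      \<le> b * history_mean k (\<lambda>\<sigma>. (norm (Z k \<sigma> - xs))\<^sup>2)"
    using W(3) by (intro mult_right_mono history_mean_nonneg) auto
  moreover have "w * P' + w * a * Q' \<le> w' * P + b * Q + w * (e - d)"
    if "w * (P' + a * Q') \<le> w * (t * P + c * Q + e - d)"
      "w * t * P \<le> w' * P" "w * c * Q \<le> b * Q" for P P' Q Q' a t c d e :: real
    using that by (simp add: algebra_simps)
  ultimately show ?thesis by blast
qed

text \<open>Weighted Cauchy-Schwarz on the delay error, with the sum of the weights over one window
  as the first factor.\<close>

lemma mean_gap_le:
  "history_mean k (\<lambda>\<sigma>. (gap k \<sigma>)\<^sup>2)
    \<le> (n * real \<tau> + ((real \<tau>)\<^sup>2 + real \<tau>) / 2) * (\<Sum>m=j k..<k. (n + real (k - m)) * ((\<theta> m)\<^sup>2 * move m))"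
proof -
  let ?T = "n * real \<tau> + ((real \<tau>)\<^sup>2 + real \<tau>) / 2"
  let ?d = "\<lambda>m \<sigma>. (norm (Z (Suc m) \<sigma> - Z m \<sigma>))\<^sup>2"
  have "(gap k \<sigma>)\<^sup>2 \<le> ?T * (\<Sum>m=j k..<k. (n + real (k - m)) * ((\<theta> m)\<^sup>2 * ?d m \<sigma>))"
    if \<sigma>: "length \<sigma> = k" for \<sigma>
  proof -
    have "gap k \<sigma> \<le> (\<Sum>m=j k..<k. (n + real (k - m)) * (\<theta> m * norm (Z (Suc m) \<sigma> - Z m \<sigma>)))"
      unfolding n_def
      by (rule delayed_extrapolation_error) (use \<theta> delay X_Suc[where \<sigma> = \<sigma>] \<sigma> in \<open>auto simp: n_def\<close>)
    then have "(gap k \<sigma>)\<^sup>2 \<le> (\<Sum>m=j k..<k. (n + real (k - m)) * (\<theta> m * norm (Z (Suc m) \<sigma> - Z m \<sigma>)))\<^sup>2"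
      by (intro power_mono) auto
    also have "\<dots> \<le> (\<Sum>m=j k..<k. n + real (k - m))
        * (\<Sum>m=j k..<k. (n + real (k - m)) * (\<theta> m * norm (Z (Suc m) \<sigma> - Z m \<sigma>))\<^sup>2)"
      using n1 by (intro weighted_sum_squared_le) simp
    also have "\<dots> \<le> ?T * (\<Sum>m=j k..<k. (n + real (k - m)) * (\<theta> m * norm (Z (Suc m) \<sigma> - Z m \<sigma>))\<^sup>2)"
      using n1 delay by (intro mult_right_mono sum_delay_window_le sum_nonneg mult_nonneg_nonneg) auto
    finally show ?thesis by (simp add: power_mult_distrib)
  qed
  then have "history_mean k (\<lambda>\<sigma>. (gap k \<sigma>)\<^sup>2)
      \<le> history_mean k (\<lambda>\<sigma>. ?T * (\<Sum>m=j k..<k. (n + real (k - m)) * ((\<theta> m)\<^sup>2 * ?d m \<sigma>)))"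
    by (rule history_mean_mono)
  also have "\<dots> = ?T * (\<Sum>m=j k..<k. (n + real (k - m)) * ((\<theta> m)\<^sup>2 * history_mean k (?d m)))"
    by (simp only: history_mean_cmult history_mean_sum)
  also have "\<dots> = ?T * (\<Sum>m=j k..<k. (n + real (k - m)) * ((\<theta> m)\<^sup>2 * move m))"
  proof -
    \<comment> \<open>A move in step \<open>m < k\<close> depends on the first \<open>m + 1\<close>
      coordinates alone.\<close>
    have "history_mean k (?d m) = move m" if "m < k" for m
      using that by (intro history_mean_prefix) (auto simp: prefix)
    then show ?thesis by simp
  qed
  finally show ?thesis .
qed

text \<open>\<open>W k\<close> and \<open>B k\<close> are the weights of the two terms of the potential before step \<open>k\<close>. The cross term with
  \<open>y\<^sup>k - w\<close> was split with ratio \<open>1/n\<close>; the factor \<open>\<rho>\<close> measures how fast the weights may grow within a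
  delay window, and any \<open>\<rho> \<le> 4\<close> is affordable in part (i).\<close>

lemma mean_bound:
  fixes W B :: "nat \<Rightarrow> real" and \<rho> :: real
  assumes W0: "\<And>k. 0 \<le> W k"
    and W: "\<And>k. W (Suc k) * (1 - \<theta> k) \<le> W k"
    and B_Suc: "\<And>k. B (Suc k) = W (Suc k) * (n * A k)"
    and B: "\<And>k. W (Suc k) * ((n - 1) * A k + n * (\<theta> k)\<^sup>2 / (2 * \<gamma>)) \<le> B k"
    and \<rho>: "\<And>k m. m \<le> k \<Longrightarrow> k \<le> m + \<tau> \<Longrightarrow> W (Suc k) \<le> \<rho> * W (Suc m)"
    and step_size: "2 * \<gamma> * L
      + (1 + 1 / n) * \<rho> / 4 * \<gamma> * L * (((real \<tau>)\<^sup>2 + real \<tau>) / n + 2 * real \<tau>)\<^sup>2 \<le> 1"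
  shows "W N * (history_mean N (\<lambda>\<sigma>. f (X N \<sigma>) + hsum (X N \<sigma>)) - opt)
      + B N * history_mean N (\<lambda>\<sigma>. (norm (Z N \<sigma> - xs))\<^sup>2)
    \<le> W 0 * (f 0 + hsum 0 - opt) + B 0 * (norm xs)\<^sup>2"
proof -
  define T where "T = n * real \<tau> + ((real \<tau>)\<^sup>2 + real \<tau>) / 2"
  define V where "V k = W k * (history_mean k (\<lambda>\<sigma>. f (X k \<sigma>) + hbar k \<sigma>) - opt)
      + B k * history_mean k (\<lambda>\<sigma>. (norm (Z k \<sigma> - xs))\<^sup>2)" for k
  define E where "E k = W (Suc k) * history_mean k (\<lambda>\<sigma>. (gap k \<sigma>)\<^sup>2)" for k
  define d where "d k = W (Suc k) * ((\<theta> k)\<^sup>2 * move k)" for k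
  define \<alpha> where "\<alpha> = L / 2 * (1 + 1 / n)"
  define \<beta> where "\<beta> = n\<^sup>2 * (1 / (2 * \<gamma>) - L)"
  have L0: "0 \<le> L" by (rule coord_lipschitz_nonneg[OF f(3)])
  have T0: "0 \<le> T" using n1 by (simp add: T_def)
  have \<alpha>0: "0 \<le> \<alpha>" using L0 n1 by (simp add: \<alpha>_def)
  have d0: "0 \<le> d k" for k
    using W0 by (simp add: d_def history_mean_nonneg)
  \<comment> \<open>The potential may rise by the delay error in \<open>E\<close>; the moves in
    \<open>d\<close> have to pay for it, which is only possible after summation over
    \<open>k\<close>.\<close>
  have "V (Suc k) \<le> V k + (\<alpha> * E k - \<beta> * d k)" for k
    using mean_step[OF W0[of "Suc k"] W[of k] B[of k]]
    by (simp add: V_def B_Suc E_def d_def \<alpha>_def \<beta>_def right_diff_distrib mult_ac)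
  then have V: "V N \<le> V 0 + (\<Sum>k<N. \<alpha> * E k - \<beta> * d k)"
    by (induction N) (auto, smt (verit))
  have E: "E k \<le> T * \<rho> * (\<Sum>m=j k..<k. (n + real (k - m)) * d m)" for k
  proof -
    have "E k \<le> W (Suc k) * (T * (\<Sum>m=j k..<k. (n + real (k - m)) * ((\<theta> m)\<^sup>2 * move m)))"
      unfolding E_def T_def by (intro mult_left_mono mean_gap_le W0)
    also have "\<dots> = T * (\<Sum>m=j k..<k. (n + real (k - m)) * (W (Suc k) * ((\<theta> m)\<^sup>2 * move m)))"
      by (simp add: sum_distrib_left mult_ac)
    also have "\<dots> \<le> T * (\<Sum>m=j k..<k. (n + real (k - m)) * (\<rho> * W (Suc m) * ((\<theta> m)\<^sup>2 * move m)))"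
    proof (intro mult_left_mono[OF _ T0] sum_mono mult_left_mono mult_right_mono \<rho>)
      fix m assume "m \<in> {j k..<k}"
      then show "m \<le> k" "k \<le> m + \<tau>" using delay(1)[of k] by auto
    qed (use n1 in \<open>auto intro!: history_mean_nonneg mult_nonneg_nonneg\<close>)
    also have "\<dots> = T * \<rho> * (\<Sum>m=j k..<k. (n + real (k - m)) * d m)"
      by (simp add: sum_distrib_left d_def mult_ac)
    finally show ?thesis .
  qed
  \<comment> \<open>The growth hypothesis at equal indices reads
    \<open>W (Suc k) \<le> \<rho> * W (Suc k)\<close>, which supplies the sign.\<close>
  have \<rho>d: "0 \<le> \<rho> * d k" for k
    using \<rho>[of k k] W0[of "Suc k"] by (simp add: d_def mult.assoc[symmetric] history_mean_nonneg)
  have "(\<Sum>k<N. E k) \<le> (\<Sum>k<N. T * \<rho> * (\<Sum>m=j k..<k. (n + real (k - m)) * d m))"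
    by (intro sum_mono E)
  also have "\<dots> = T * (\<Sum>k<N. \<Sum>m=j k..<k. (n + real (k - m)) * (\<rho> * d m))"
    by (simp add: sum_distrib_left mult_ac)
  also have "\<dots> \<le> T * (T * (\<Sum>m<N. \<rho> * d m))"
    unfolding T_def
    by (intro mult_left_mono delayed_double_sum_le \<rho>d delay T0[unfolded T_def]) (use n1 in auto)
  finally have "\<alpha> * (\<Sum>k<N. E k) \<le> \<alpha> * (T\<^sup>2 * \<rho> * (\<Sum>m<N. d m))"
    using \<alpha>0 by (intro mult_left_mono) (simp_all add: power2_eq_square sum_distrib_left mult_ac)
  \<comment> \<open>This is the step size condition multiplied by
    \<open>n\<^sup>2 / (2 * \<gamma>)\<close>.\<close>
  moreover have "\<alpha> * T\<^sup>2 * \<rho> \<le> \<beta>"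
  proof -
    have T: "((real \<tau>)\<^sup>2 + real \<tau>) / n + 2 * real \<tau> = 2 * T / n"
      using n1 by (simp add: T_def field_simps)
    have "n\<^sup>2 / (2 * \<gamma>) * (2 * \<gamma> * L + (1 + 1 / n) * \<rho> / 4 * \<gamma> * L * (2 * T / n)\<^sup>2) \<le> n\<^sup>2 / (2 * \<gamma>) * 1"
      using step_size \<gamma> unfolding T by (intro mult_left_mono) auto
    moreover have "n\<^sup>2 / (2 * \<gamma>) * (2 * \<gamma> * L + (1 + 1 / n) * \<rho> / 4 * \<gamma> * L * (2 * T / n)\<^sup>2)
        = n\<^sup>2 * L + \<alpha> * T\<^sup>2 * \<rho>"
      using n1 \<gamma> by (simp add: \<alpha>_def field_simps power2_eq_square)
    ultimately show ?thesis by (simp add: \<beta>_def right_diff_distrib)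
  qed
  then have "\<alpha> * T\<^sup>2 * \<rho> * (\<Sum>m<N. d m) \<le> \<beta> * (\<Sum>m<N. d m)"
    by (intro mult_right_mono sum_nonneg d0) auto
  ultimately have "V N \<le> V 0"
    using V by (simp add: sum_subtractf sum_distrib_left[symmetric] mult.assoc)
  moreover have "W N * (history_mean N (\<lambda>\<sigma>. f (X N \<sigma>) + hsum (X N \<sigma>)) - opt)
      \<le> W N * (history_mean N (\<lambda>\<sigma>. f (X N \<sigma>) + hbar N \<sigma>) - opt)"
    using hsum_X_le_hbar[of N] by (intro mult_left_mono W0 diff_right_mono history_mean_mono) auto
  \<comment> \<open>At index 0 the hull consists of the single point 0, so \<open>hbar\<close> there
    is \<open>hsum 0\<close>.\<close>
  ultimately show ?thesis
    by (simp add: V_def init hull_weight_0)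
qed

end

section \<open>From paths to histories\<close>

definition history :: "(nat \<Rightarrow> 'a \<Rightarrow> 'n) \<Rightarrow> nat \<Rightarrow> 'a \<Rightarrow> 'n list" where
  "history c k \<omega> = map (\<lambda>m. c m \<omega>) [0..<k]"

lemma length_history [simp]: "length (history c k \<omega>) = k"
  by (simp add: history_def)

lemma history_eq_iff: "length \<sigma> = k \<Longrightarrow> history c k \<omega> = \<sigma> \<longleftrightarrow> (\<forall>m<k. c m \<omega> = \<sigma> ! m)"
  by (auto simp: history_def list_eq_iff_nth_eq)

context
  fixes M :: "'a measure" and c :: "nat \<Rightarrow> 'a \<Rightarrow> 'n::finite"
  assumes coords: "uniform_coordinates M c"
begin

interpretation prob_space M
  using coords by (simp add: uniform_coordinates_def)

lemma measurable_coordinate: "c m \<in> measurable M (count_space UNIV)"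
  using coords by (simp add: uniform_coordinates_def indep_vars_def)

lemma sets_history:
  assumes "length \<sigma> = k"
  shows "{\<omega> \<in> space M. history c k \<omega> = \<sigma>} \<in> sets M"
proof -
  have "{\<omega> \<in> space M. c m \<omega> = i} \<in> sets M" for m i
    using measurable_sets[OF measurable_coordinate[of m], of "{i}"]
    by (simp add: vimage_def Int_def conj_commute)
  then have "{\<omega> \<in> space M. \<forall>m\<in>{..<k}. c m \<omega> = \<sigma> ! m} \<in> sets M"
    by (intro sets.sets_Collect_finite_All) auto
  then show ?thesis by (simp only: history_eq_iff[OF assms] Ball_def lessThan_iff)
qed

lemma prob_history:
  assumes "length \<sigma> = k"
  shows "prob {\<omega> \<in> space M. history c k \<omega> = \<sigma>} = 1 / real CARD('n) ^ k"
\<comment> \<open>For \<open>k = 0\<close> the intersection below would be \<open>UNIV\<close>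
  instead of \<open>space M\<close>.\<close>
proof (cases "k = 0")
  case True
  with assms show ?thesis by (simp add: history_def prob_space)
next
  case False
  have indep: "indep_vars (\<lambda>_. count_space UNIV) c UNIV"
    using coords by (simp add: uniform_coordinates_def)
  have "{\<omega> \<in> space M. history c k \<omega> = \<sigma>} = (\<Inter>m\<in>{..<k}. c m -` {\<sigma> ! m} \<inter> space M)"
    using False assms by (auto simp: history_eq_iff)
  also have "prob \<dots> = (\<Prod>m<k. prob (c m -` {\<sigma> ! m} \<inter> space M))"
    using False by (intro indep_varsD[OF indep]) auto
  also have "\<dots> = (\<Prod>m<k. 1 / real CARD('n))"
  proof (rule prod.cong[OF refl])
    fix m
    have "c m -` {\<sigma> ! m} \<inter> space M = {\<omega> \<in> space M. c m \<omega> = \<sigma> ! m}" by auto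
    then show "prob (c m -` {\<sigma> ! m} \<inter> space M) = 1 / real CARD('n)"
      using coords by (simp add: uniform_coordinates_def)
  qed
  finally show ?thesis by (simp add: power_one_over)
qed

text \<open>An event of positive probability is nonempty.\<close>

lemma history_realized: "\<exists>\<omega>\<in>space M. history c (length \<sigma>) \<omega> = \<sigma>"
proof (rule ccontr)
  assume "\<not> ?thesis"
  then have "{\<omega> \<in> space M. history c (length \<sigma>) \<omega> = \<sigma>} = {}" by auto
  with prob_history[of \<sigma> "length \<sigma>"] show False by (simp only: measure_empty) simp
qed

text \<open>\<open>G\<close> is constant on each of the finitely many history events, so it is a
  simple function.\<close>

lemma has_bochner_integral_history:
  assumes "\<And>\<omega>. \<omega> \<in> space M \<Longrightarrow> G \<omega> = g (history c k \<omega>)"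
  shows "has_bochner_integral M G (history_mean k g)"
proof -
  let ?A = "\<lambda>\<sigma>. {\<omega> \<in> space M. history c k \<omega> = \<sigma>}"
  have "has_bochner_integral M (\<lambda>\<omega>. \<Sum>\<sigma> | length \<sigma> = k. g \<sigma> * indicator (?A \<sigma>) \<omega>)
      (\<Sum>\<sigma> | length \<sigma> = k. g \<sigma> * prob (?A \<sigma>))"
    by (intro has_bochner_integral_sum has_bochner_integral_mult_right has_bochner_integral_real_indicator sets_history)
      (simp_all add: emeasure_eq_measure)
  also have "(\<Sum>\<sigma> | length \<sigma> = k. g \<sigma> * prob (?A \<sigma>)) = history_mean k g"
    by (simp add: prob_history history_mean_def sum_divide_distrib)
  finally show ?thesis
  proof (rule has_bochner_integral_cong[THEN iffD1, rotated -1])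
    fix \<omega> assume \<omega>: "\<omega> \<in> space M"
    have "(\<Sum>\<sigma> | length \<sigma> = k. g \<sigma> * indicator (?A \<sigma>) \<omega>)
        = (\<Sum>\<sigma> | length \<sigma> = k. if \<sigma> = history c k \<omega> then g \<sigma> else 0)"
      using \<omega> by (intro sum.cong) (auto simp: indicator_def)
    also have "\<dots> = g (history c k \<omega>)"
      by (subst sum.delta) auto
    finally show "(\<Sum>\<sigma> | length \<sigma> = k. g \<sigma> * indicator (?A \<sigma>) \<omega>) = G \<omega>"
      using assms[OF \<omega>] by simp
  qed simp_all
qed

text \<open>Both the positive and the negative part have finite integral, so their difference is the
  Bochner integral.\<close>

lemma ereal_expectation_history:
  assumes "\<And>\<omega>. \<omega> \<in> space M \<Longrightarrow> G \<omega> = ereal (g (history c k \<omega>))"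
  shows "ereal_expectation M G = ereal (history_mean k g)"
proof -
  let ?G = "\<lambda>\<omega>. g (history c k \<omega>)"
  have int: "integrable M ?G" "(\<integral>\<omega>. ?G \<omega> \<partial>M) = history_mean k g"
    using has_bochner_integral_history[of ?G g k] by (auto simp: has_bochner_integral_iff)
  have pos: "(\<integral>\<^sup>+ \<omega>. e2ennreal (G \<omega>) \<partial>M) = (\<integral>\<^sup>+ \<omega>. ennreal (?G \<omega>) \<partial>M)"
    by (intro nn_integral_cong) (simp add: assms e2ennreal_ereal)
  have neg: "(\<integral>\<^sup>+ \<omega>. e2ennreal (- G \<omega>) \<partial>M) = (\<integral>\<^sup>+ \<omega>. ennreal (- ?G \<omega>) \<partial>M)"
    by (intro nn_integral_cong) (simp add: assms e2ennreal_ereal)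
  have fin: "enn2ereal e = ereal (enn2real e)" if "e < top" for e
    using that by (cases e) (auto simp: enn2ereal_ennreal)
  have "(\<integral>\<^sup>+ \<omega>. ennreal (?G \<omega>) \<partial>M) < top" "(\<integral>\<^sup>+ \<omega>. ennreal (- ?G \<omega>) \<partial>M) < top"
    using int(1) by (auto simp: real_integrable_def top.not_eq_extremum)
  then show ?thesis
    unfolding ereal_expectation_def pos neg int(2)[symmetric] real_lebesgue_integral_def[OF int(1)]
    by (simp add: fin)
qed

end

section \<open>Finite parts of extended-valued functions and proximal steps\<close>

lemma convex_on_real_of_ereal:
  fixes G :: "'b::real_vector \<Rightarrow> ereal"
  assumes G: "\<And>t. G t \<noteq> -\<infinity>" and conv: "ereal_convex (\<lambda>t. G t - ereal (q t))"
  shows "convex_on {t. G t \<noteq> \<infinity>} (\<lambda>t. real_of_ereal (G t) - q t)"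
proof -
  \<comment> \<open>Finite values at both ends force a finite value between them, so the domain is
    convex too.\<close>
  have key: "G (u *\<^sub>R x + v *\<^sub>R y) \<noteq> \<infinity> \<and> real_of_ereal (G (u *\<^sub>R x + v *\<^sub>R y)) - q (u *\<^sub>R x + v *\<^sub>R y)
      \<le> u * (real_of_ereal (G x) - q x) + v * (real_of_ereal (G y) - q y)"
    if fin: "G x \<noteq> \<infinity>" "G y \<noteq> \<infinity>" and uv: "0 \<le> u" "0 \<le> v" "u + v = 1" for x y u v
  proof -
    obtain a b where ab: "G x = ereal a" "G y = ereal b"
      using fin G[of x] G[of y] by (cases "G x"; cases "G y") auto
    have "G (u *\<^sub>R x + v *\<^sub>R y) - ereal (q (u *\<^sub>R x + v *\<^sub>R y))
        \<le> ereal u * (G x - ereal (q x)) + ereal v * (G y - ereal (q y))"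
      using conv uv by (simp add: ereal_convex_def)
    then show ?thesis
      using G[of "u *\<^sub>R x + v *\<^sub>R y"] by (cases "G (u *\<^sub>R x + v *\<^sub>R y)") (auto simp: ab)
  qed
  show ?thesis
    unfolding convex_on_def convex_def using key by blast
qed

text \<open>Properness supplies a point of finite objective value, so the minimal value is finite.
  The second claim passes from increments \<open>d\<close> to points
  \<open>b = z + d\<close>.\<close>

lemma arg_min_real_of_ereal:
  fixes G :: "real \<Rightarrow> ereal"
  assumes G: "proper_fun G"
    and min: "is_arg_min (\<lambda>d. G (z + d) + ereal (\<phi> d)) (\<lambda>_. True) \<delta>"
  shows "G (z + \<delta>) \<noteq> \<infinity>"
    and "G b \<noteq> \<infinity> \<Longrightarrow> real_of_ereal (G (z + \<delta>)) + \<phi> \<delta> \<le> real_of_ereal (G b) + \<phi> (b - z)"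
proof -
  have le: "G (z + \<delta>) + ereal (\<phi> \<delta>) \<le> G b + ereal (\<phi> (b - z))" for b
    using min[unfolded is_arg_min_def] by (auto simp: not_less dest: spec[of _ "b - z"])
  have ninf: "G b \<noteq> -\<infinity>" for b using G by (simp add: proper_fun_def)
  obtain p where "G p \<noteq> \<infinity>" using G by (auto simp: proper_fun_def)
  with le[of p] show fin: "G (z + \<delta>) \<noteq> \<infinity>"
    using ninf[of p] by (cases "G p") auto
  assume "G b \<noteq> \<infinity>"
  with le[of b] fin ninf[of b] ninf[of "z + \<delta>"]
  show "real_of_ereal (G (z + \<delta>)) + \<phi> \<delta> \<le> real_of_ereal (G b) + \<phi> (b - z)"
    by (cases "G b"; cases "G (z + \<delta>)") auto
qed

lemma arg_min_three_point:
  fixes G :: "real \<Rightarrow> ereal"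
  assumes G: "proper_fun G" and conv: "convex_on {t. G t \<noteq> \<infinity>} (\<lambda>t. real_of_ereal (G t) - \<mu> / 2 * t\<^sup>2)"
    and min: "is_arg_min (\<lambda>d. G (z + d) + ereal (g * d + q * d\<^sup>2)) (\<lambda>_. True) \<delta>"
    and a: "G a \<noteq> \<infinity>"
  shows "real_of_ereal (G (z + \<delta>)) + g * (z + \<delta>) + q * \<delta>\<^sup>2 + (q + \<mu> / 2) * (z + \<delta> - a)\<^sup>2
    \<le> real_of_ereal (G a) + g * a + q * (a - z)\<^sup>2"
  using three_point_inequality[OF conv, of a "z + \<delta>" g q z] a
    arg_min_real_of_ereal[OF G min] by (simp add: algebra_simps)

text \<open>Uniqueness of the proximal step makes the iterates functions of the coordinate history, which also
  settles their measurability.\<close>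

lemma arg_min_unique:
  fixes G :: "real \<Rightarrow> ereal"
  assumes G: "proper_fun G" and conv: "ereal_convex G" and q: "0 < q"
    and min: "is_arg_min (\<lambda>d. G (z + d) + ereal (g * d + q * d\<^sup>2)) (\<lambda>_. True) \<delta>"
      "is_arg_min (\<lambda>d. G (z + d) + ereal (g * d + q * d\<^sup>2)) (\<lambda>_. True) \<delta>'"
  shows "\<delta> = \<delta>'"
proof -
  have "convex_on {t. G t \<noteq> \<infinity>} (\<lambda>t. real_of_ereal (G t) - 0 / 2 * t\<^sup>2)"
    using conv G by (intro convex_on_real_of_ereal) (auto simp: proper_fun_def zero_ereal_def[symmetric])
  \<comment> \<open>Each minimizer is the comparison point for the other; in the sum of the two
    inequalities only the squares survive.\<close>
  from arg_min_three_point[OF G this min(1) arg_min_real_of_ereal(1)[OF G min(2)]]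
    arg_min_three_point[OF G this min(2) arg_min_real_of_ereal(1)[OF G min(1)]]
  have "q * (\<delta> - \<delta>')\<^sup>2 + q * (\<delta>' - \<delta>)\<^sup>2 \<le> 0" by (simp add: algebra_simps)
  then have "q * (\<delta> - \<delta>')\<^sup>2 \<le> 0" by (simp add: power2_commute)
  with q show ?thesis by (simp add: mult_le_0_iff)
qed

text \<open>Equal coordinates and equal past give the same proximal problem, hence the same
  increment. The induction assumes all earlier indices at once because the compensated point reads
  iterates at the delayed index.\<close>

lemma aascd_path_determined:
  assumes path: "aascd_path f h \<theta> \<gamma> j c x z" "aascd_path f h \<theta> \<gamma> j c' x' z'"
    and h: "\<And>i. proper_fun (h i)" "\<And>i. ereal_convex (h i)"
    and \<theta>: "\<And>k. 0 < \<theta> k" and \<gamma>: "0 < \<gamma>" and j: "\<And>k. j k \<le> k"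
    and c: "\<And>m. m < k \<Longrightarrow> c m = c' m"
  shows "m \<le> k \<Longrightarrow> x m = x' m \<and> z m = z' m"
proof (induction m rule: less_induct)
  case (less m)
  show ?case
  proof (cases m)
    case 0
    then show ?thesis using path by (simp add: aascd_path_def)
  next
    case (Suc l)
    have eq: "x i = x' i" "z i = z' i" if "i \<le> l" for i
      using less that Suc by auto
    have comp: "compensated \<theta> j x z l = compensated \<theta> j x' z' l"
      using j[of l] by (simp add: compensated_def extrapolation_def Let_def eq)
    have cl: "c' l = c l" using c[of l] less.prems Suc by simp
    obtain \<delta> where \<delta>: "is_arg_min
          (\<lambda>d. h (c l) (z l $ c l + d) + ereal (partial_deriv (c l) f (compensated \<theta> j x z l) * d
                      + real CARD('a) * \<theta> l / (2 * \<gamma>) * d\<^sup>2)) (\<lambda>_. True) \<delta>"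
        "z (Suc l) = (\<chi> i. if i = c l then z l $ i + \<delta> else z l $ i)"
        "x (Suc l) = (1 - \<theta> l) *\<^sub>R x l + (real CARD('a) * \<theta> l) *\<^sub>R z (Suc l)
                    - ((real CARD('a) - 1) * \<theta> l) *\<^sub>R z l"
      using path(1) unfolding aascd_path_def by blast
    obtain \<delta>' where \<delta>': "is_arg_min
          (\<lambda>d. h (c' l) (z' l $ c' l + d) + ereal (partial_deriv (c' l) f (compensated \<theta> j x' z' l) * d
                      + real CARD('a) * \<theta> l / (2 * \<gamma>) * d\<^sup>2)) (\<lambda>_. True) \<delta>'"
        "z' (Suc l) = (\<chi> i. if i = c' l then z' l $ i + \<delta>' else z' l $ i)"
        "x' (Suc l) = (1 - \<theta> l) *\<^sub>R x' l + (real CARD('a) * \<theta> l) *\<^sub>R z' (Suc l)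
                    - ((real CARD('a) - 1) * \<theta> l) *\<^sub>R z' l"
      using path(2) unfolding aascd_path_def by blast
    have "\<delta> = \<delta>'"
    proof (rule arg_min_unique[OF h])
      show "0 < real CARD('a) * \<theta> l / (2 * \<gamma>)" using \<theta>[of l] \<gamma> by simp
    qed (use \<delta>(1) \<delta>'(1) in \<open>simp_all add: cl eq comp\<close>)
    then have "z (Suc l) = z' (Suc l)"
      unfolding \<delta>(2) \<delta>'(2) cl eq(2)[OF order_refl] by (rule arg_cong)
    moreover from this have "x (Suc l) = x' (Suc l)"
      unfolding \<delta>(3) \<delta>'(3) eq[OF order_refl] by simp
    ultimately show ?thesis by (simp add: Suc)
  qed
qed

lemma separable_sum_not_MInfty:
  assumes "\<And>i t. h i t \<noteq> -\<infinity>"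
  shows "separable_sum h u \<noteq> -\<infinity>"
proof -
  have "(\<Sum>i\<in>I. h i (u $ i)) \<noteq> -\<infinity>" if "finite I" for I
    using that by (induction I) (auto simp: assms)
  then show ?thesis by (simp add: separable_sum_def)
qed

text \<open>Strong convexity is assumed for the sum, but the proximal step needs it for one
  coordinate. On the axis-parallel line through a point \<open>p\<close> of finite value, the other
  coordinates add only the constants \<open>C\<close> and \<open>N\<close>.\<close>

lemma strongly_convex_coordinate:
  fixes h :: "'n::finite \<Rightarrow> real \<Rightarrow> ereal" and p :: "real ^ 'n"
  assumes sc: "strongly_convex (separable_sum h) \<mu>"
    and h: "\<And>i t. h i t \<noteq> -\<infinity>" and p: "\<And>i. h i (p $ i) \<noteq> \<infinity>"
  shows "convex_on {t. h i t \<noteq> \<infinity>} (\<lambda>t. real_of_ereal (h i t) - \<mu> / 2 * t\<^sup>2)"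
proof -
  define P where "P t = p + (t - p $ i) *\<^sub>R axis i 1" for t
  define C where "C = (\<Sum>l\<in>UNIV - {i}. real_of_ereal (h l (p $ l)))"
  define N where "N = (\<Sum>l\<in>UNIV - {i}. (p $ l)\<^sup>2)"
  have P_nth: "P t $ l = (if l = i then t else p $ l)" for t l
    by (simp add: P_def axis_def)
  have sum: "(\<Sum>l\<in>UNIV. G l (P t $ l)) = G i t + (\<Sum>l\<in>UNIV - {i}. G l (p $ l))"
    for t and G :: "'n \<Rightarrow> real \<Rightarrow> 'c::comm_monoid_add"
    by (subst sum.remove[of _ i]) (simp_all add: P_nth)
  have "(\<Sum>l\<in>UNIV - {i}. h l (p $ l)) = (\<Sum>l\<in>UNIV - {i}. ereal (real_of_ereal (h l (p $ l))))"
  proof (intro sum.cong refl)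
    fix l show "h l (p $ l) = ereal (real_of_ereal (h l (p $ l)))"
      using h[of l "p $ l"] p[of l] by (cases "h l (p $ l)") auto
  qed
  then have sep: "separable_sum h (P t) = h i t + ereal C" for t
    by (simp add: separable_sum_def sum C_def)
  have norm: "(norm (P t))\<^sup>2 = t\<^sup>2 + N" for t
    unfolding power2_norm_eq_inner using sum[of "\<lambda>_ s. s\<^sup>2" t] by (simp add: inner_vec_def power2_eq_square N_def)
  have ninf: "separable_sum h u \<noteq> -\<infinity>" for u
    using h by (rule separable_sum_not_MInfty)
  let ?S = "{u. separable_sum h u \<noteq> \<infinity>}"
  have conv: "convex_on ?S (\<lambda>u. real_of_ereal (separable_sum h u) - \<mu> / 2 * (norm u)\<^sup>2)"
    using sc ninf by (intro convex_on_real_of_ereal) (auto simp: strongly_convex_def)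
  have affine: "P (u *\<^sub>R a + v *\<^sub>R b) = u *\<^sub>R P a + v *\<^sub>R P b" if "u + v = 1" for u v a b
    using that by (simp add: vec_eq_iff P_nth distrib_right[symmetric])
  have S: "P t \<in> ?S \<longleftrightarrow> h i t \<noteq> \<infinity>" for t
    by (simp add: sep)
  have real: "real_of_ereal (separable_sum h (P t)) - \<mu> / 2 * (norm (P t))\<^sup>2
      = real_of_ereal (h i t) - \<mu> / 2 * t\<^sup>2 + (C - \<mu> / 2 * N)" if "h i t \<noteq> \<infinity>" for t
    using that h[of i t] by (cases "h i t") (auto simp: sep norm algebra_simps)
  show ?thesis
    unfolding convex_on_def
  proof (intro conjI ballI allI impI)
    show "convex {t. h i t \<noteq> \<infinity>}"
      unfolding convex_def
    proof (intro ballI allI impI)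
      fix a b u v :: real
      assume "a \<in> {t. h i t \<noteq> \<infinity>}" "b \<in> {t. h i t \<noteq> \<infinity>}" and uv: "0 \<le> u" "0 \<le> v" "u + v = 1"
      then have "P (u *\<^sub>R a + v *\<^sub>R b) \<in> ?S"
        unfolding affine[OF uv(3)] using S by (intro convexD[OF convex_on_imp_convex[OF conv]]) auto
      then show "u *\<^sub>R a + v *\<^sub>R b \<in> {t. h i t \<noteq> \<infinity>}" unfolding S by simp
    qed
    fix a b u v :: real
    assume ab: "a \<in> {t. h i t \<noteq> \<infinity>}" "b \<in> {t. h i t \<noteq> \<infinity>}" and uv: "0 \<le> u" "0 \<le> v" "u + v = 1"
    have "P (u *\<^sub>R a + v *\<^sub>R b) \<in> ?S"
      unfolding affine[OF uv(3)] using S ab uv by (intro convexD[OF convex_on_imp_convex[OF conv]]) auto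
    then have fin: "h i (u *\<^sub>R a + v *\<^sub>R b) \<noteq> \<infinity>" unfolding S .
    let ?R = "\<lambda>u. real_of_ereal (separable_sum h u) - \<mu> / 2 * (norm u)\<^sup>2"
    have "?R (P (u *\<^sub>R a + v *\<^sub>R b)) \<le> u * ?R (P a) + v * ?R (P b)"
      unfolding affine[OF uv(3)] using conv S ab uv unfolding convex_on_def by blast
    then have "real_of_ereal (h i (u *\<^sub>R a + v *\<^sub>R b)) - \<mu> / 2 * (u *\<^sub>R a + v *\<^sub>R b)\<^sup>2 + (C - \<mu> / 2 * N)
        \<le> u * (real_of_ereal (h i a) - \<mu> / 2 * a\<^sup>2) + v * (real_of_ereal (h i b) - \<mu> / 2 * b\<^sup>2)
          + (u + v) * (C - \<mu> / 2 * N)"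
      unfolding real[OF fin] real[of a, OF ab(1)[unfolded mem_Collect_eq]]
        real[of b, OF ab(2)[unfolded mem_Collect_eq]]
      by (simp add: distrib_left distrib_right add_ac)
    then show "real_of_ereal (h i (u *\<^sub>R a + v *\<^sub>R b)) - \<mu> / 2 * (u *\<^sub>R a + v *\<^sub>R b)\<^sup>2
        \<le> u * (real_of_ereal (h i a) - \<mu> / 2 * a\<^sup>2) + v * (real_of_ereal (h i b) - \<mu> / 2 * b\<^sup>2)"
      unfolding uv(3) by simp
  qed
qed

section \<open>The iteration\<close>

text \<open>Common setting of both parts: part (i) takes \<open>\<mu> = 0\<close> in
  \<open>h_\<mu>\<close>. Assumption \<open>h_0\<close> places the starting point in the domain;
  otherwise the right-hand sides of the theorem are infinite.\<close>

locale aascd_process =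
  fixes f :: "real ^ 'n::finite \<Rightarrow> real" and h :: "'n \<Rightarrow> real \<Rightarrow> ereal"
    and \<theta> :: "nat \<Rightarrow> real" and L \<gamma> \<mu> n :: real and j :: "nat \<Rightarrow> nat" and \<tau> :: nat
    and xs :: "real ^ 'n" and M :: "'a measure" and c :: "nat \<Rightarrow> 'a \<Rightarrow> 'n"
    and x z :: "nat \<Rightarrow> 'a \<Rightarrow> real ^ 'n"
  assumes n_def: "n = real CARD('n)"
    and f: "convex_on UNIV f" "\<And>u. f differentiable (at u)" "coord_lipschitz f L"
    and h: "\<And>i. proper_fun (h i)" "\<And>i. ereal_convex (h i)"
    and h_\<mu>: "\<And>i. convex_on {t. h i t \<noteq> \<infinity>} (\<lambda>t. real_of_ereal (h i t) - \<mu> / 2 * t\<^sup>2)"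
    and h_0: "\<And>i. h i 0 \<noteq> \<infinity>"
    and minimizer: "\<And>u. ereal (f xs) + separable_sum h xs \<le> ereal (f u) + separable_sum h u"
    and \<gamma>: "0 < \<gamma>"
    and \<theta>: "\<And>m. 0 < \<theta> m" "\<And>m. \<theta> m \<le> 1 / n" "\<And>m. \<theta> (Suc m) \<le> \<theta> m"
    and delay: "\<And>k. k - \<tau> \<le> j k" "\<And>k. j k \<le> k"
    and coords: "uniform_coordinates M c"
    and iterates: "\<And>\<omega>. \<omega> \<in> space M \<Longrightarrow>
      aascd_path f h \<theta> \<gamma> j (\<lambda>k. c k \<omega>) (\<lambda>k. x k \<omega>) (\<lambda>k. z k \<omega>)"
begin

abbreviation D :: "'n \<Rightarrow> real set" where
  "D i \<equiv> {t. h i t \<noteq> \<infinity>}"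

abbreviation H :: "'n \<Rightarrow> real \<Rightarrow> real" where
  "H i t \<equiv> real_of_ereal (h i t)"

abbreviation \<Phi> :: "real ^ 'n \<Rightarrow> real" where
  "\<Phi> u \<equiv> f u + (\<Sum>i\<in>UNIV. H i (u $ i))"

text \<open>Every finite history has positive probability, so some sample point realizes it. In particular the
  proximal steps of the coordinates that are not chosen on one path exist on other paths.\<close>

definition rep :: "'n list \<Rightarrow> 'a" where
  "rep \<sigma> = (SOME \<omega>. \<omega> \<in> space M \<and> history c (length \<sigma>) \<omega> = \<sigma>)"

lemma rep: "rep \<sigma> \<in> space M" "history c (length \<sigma>) (rep \<sigma>) = \<sigma>"
  using someI_ex[of "\<lambda>\<omega>. \<omega> \<in> space M \<and> history c (length \<sigma>) \<omega> = \<sigma>"]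
    history_realized[OF coords, of \<sigma>] by (auto simp: rep_def)

lemma iterates_determined:
  assumes "\<omega> \<in> space M" "\<omega>' \<in> space M" "\<And>l. l < k \<Longrightarrow> c l \<omega> = c l \<omega>'" "m \<le> k"
  shows "x m \<omega> = x m \<omega>'" "z m \<omega> = z m \<omega>'"
  using aascd_path_determined[OF iterates[OF assms(1)] iterates[OF assms(2)] h \<theta>(1) \<gamma> delay(2) assms(3,4)]
  by auto

lemma rep_nth: "m < length \<sigma> \<Longrightarrow> c m (rep \<sigma>) = \<sigma> ! m"
  using rep(2)[of \<sigma>] history_eq_iff[of \<sigma> "length \<sigma>" c "rep \<sigma>"] by simp

lemma rep_snoc:
  assumes "m \<le> length \<sigma>"
  shows "x m (rep (\<sigma> @ [i])) = x m (rep \<sigma>)" "z m (rep (\<sigma> @ [i])) = z m (rep \<sigma>)"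
  using iterates_determined[OF rep(1) rep(1), of "length \<sigma>" "\<sigma> @ [i]" \<sigma> m] assms
  by (simp_all add: rep_nth nth_append)

lemma rep_history:
  assumes "\<omega> \<in> space M"
  shows "x k \<omega> = x k (rep (history c k \<omega>))" "z k \<omega> = z k (rep (history c k \<omega>))"
  using iterates_determined[OF assms rep(1), of k "history c k \<omega>" k]
  by (simp_all add: rep_nth) (simp_all add: history_def)

lemma objective_eq:
  assumes "\<And>i. u $ i \<in> D i"
  shows "ereal (f u) + separable_sum h u = ereal (\<Phi> u)"
proof -
  have "h i (u $ i) = ereal (H i (u $ i))" for i
    using assms[of i] h(1)[of i] by (cases "h i (u $ i)") (auto simp: proper_fun_def)
  then have "separable_sum h u = (\<Sum>i\<in>UNIV. ereal (H i (u $ i)))"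
    unfolding separable_sum_def by (intro sum.cong) auto
  then show ?thesis by simp
qed

text \<open>The objective is finite at 0, hence at its minimizer.\<close>

lemma xs_in_D: "xs $ i \<in> D i"
proof (rule ccontr)
  assume "xs $ i \<notin> D i"
  then have "separable_sum h xs = \<infinity>"
    by (auto simp: separable_sum_def sum_Pinfty)
  with minimizer[of 0] objective_eq[of 0] h_0 show False by simp
qed

lemma path_step:
  assumes "\<omega> \<in> space M"
  obtains d where "is_arg_min (\<lambda>d. h (c k \<omega>) (z k \<omega> $ c k \<omega> + d) +
        ereal (gradient f (compensated \<theta> j (\<lambda>m. x m \<omega>) (\<lambda>m. z m \<omega>) k) $ c k \<omega> * d
          + n * \<theta> k / (2 * \<gamma>) * d\<^sup>2)) (\<lambda>_. True) d"
    and "z (Suc k) \<omega> = z k \<omega> + d *\<^sub>R axis (c k \<omega>) 1"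
    and "x (Suc k) \<omega> = (1 - \<theta> k) *\<^sub>R x k \<omega> + (n * \<theta> k) *\<^sub>R z (Suc k) \<omega> - ((n - 1) * \<theta> k) *\<^sub>R z k \<omega>"
proof -
  have axis: "(\<chi> i. if i = l then v $ i + d else v $ i) = v + d *\<^sub>R axis l 1" for v :: "real ^ 'n" and l d
    by (simp add: vec_eq_iff axis_def)
  have grad: "gradient f p $ i = partial_deriv i f p" for p i
    by (simp add: gradient_def)
  show ?thesis
    using iterates[OF assms] that unfolding aascd_path_def n_def axis grad by blast
qed

text \<open>The step with coordinate \<open>i\<close> after history \<open>\<sigma>\<close> is read
  off the path \<open>rep (\<sigma> @ [i])\<close>, whose iterates up to the length of
  \<open>\<sigma>\<close> agree with those of \<open>rep \<sigma>\<close>.\<close>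

sublocale tree: aascd_tree f H D \<theta> L \<gamma> \<mu> n j \<tau> xs "\<lambda>m \<sigma>. x m (rep \<sigma>)" "\<lambda>m \<sigma>. z m (rep \<sigma>)"
proof
  show "convex_on (D i) (H i)" for i
    using convex_on_real_of_ereal[of "h i" "\<lambda>_. 0"] h[of i]
    by (simp add: proper_fun_def zero_ereal_def[symmetric])
  show "\<Phi> xs \<le> \<Phi> u" if "\<And>i. u $ i \<in> D i" for u
    using minimizer[of u] objective_eq[OF that] objective_eq[OF xs_in_D] by simp
  show "x 0 (rep \<sigma>) = 0" "z 0 (rep \<sigma>) = 0" for \<sigma>
    using iterates[OF rep(1)] by (simp_all add: aascd_path_def)
  show "x (Suc m) (rep \<sigma>) = (1 - \<theta> m) *\<^sub>R x m (rep \<sigma>) + (n * \<theta> m) *\<^sub>R z (Suc m) (rep \<sigma>)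
      - ((n - 1) * \<theta> m) *\<^sub>R z m (rep \<sigma>)" for m \<sigma>
    using path_step[OF rep(1), of m] by metis
  fix k and \<sigma> :: "'n list" and i :: 'n
  assume \<sigma>: "length \<sigma> = k"
  define g where "g = gradient f (compensated \<theta> j (\<lambda>m. x m (rep \<sigma>)) (\<lambda>m. z m (rep \<sigma>)) k) $ i"
  have ck: "c k (rep (\<sigma> @ [i])) = i"
    using \<sigma> by (simp add: rep_nth nth_append)
  have comp: "compensated \<theta> j (\<lambda>m. x m (rep (\<sigma> @ [i]))) (\<lambda>m. z m (rep (\<sigma> @ [i]))) k
      = compensated \<theta> j (\<lambda>m. x m (rep \<sigma>)) (\<lambda>m. z m (rep \<sigma>)) k"
    using delay(2)[of k] \<sigma> by (simp add: compensated_def extrapolation_def rep_snoc)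
  obtain d where min: "is_arg_min (\<lambda>d. h i (z k (rep \<sigma>) $ i + d) +
        ereal (g * d + n * \<theta> k / (2 * \<gamma>) * d\<^sup>2)) (\<lambda>_. True) d"
    and Z: "z (Suc k) (rep (\<sigma> @ [i])) = z k (rep \<sigma>) + d *\<^sub>R axis i 1"
    using path_step[OF rep(1), of k "\<sigma> @ [i]"] \<sigma> unfolding ck comp g_def[symmetric]
    by (auto simp: rep_snoc)
  show "\<exists>d. z (Suc k) (rep (\<sigma> @ [i])) = z k (rep \<sigma>) + d *\<^sub>R axis i 1 \<and>
      z k (rep \<sigma>) $ i + d \<in> D i \<and>
      (let g = gradient f (compensated \<theta> j (\<lambda>m. x m (rep \<sigma>)) (\<lambda>m. z m (rep \<sigma>)) k) $ i in
        H i (z k (rep \<sigma>) $ i + d) + g * (z k (rep \<sigma>) $ i + d) + n * \<theta> k / (2 * \<gamma>) * d\<^sup>2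
          + (n * \<theta> k / (2 * \<gamma>) + \<mu> / 2) * (z k (rep \<sigma>) $ i + d - xs $ i)\<^sup>2
        \<le> H i (xs $ i) + g * xs $ i + n * \<theta> k / (2 * \<gamma>) * (xs $ i - z k (rep \<sigma>) $ i)\<^sup>2)"
    unfolding Let_def g_def[symmetric]
    using Z arg_min_real_of_ereal(1)[OF h(1) min] arg_min_three_point[OF h(1) h_\<mu> min] xs_in_D
    by blast
qed (use n_def f h_0 \<gamma> \<theta> delay rep_snoc in auto)

text \<open>The iterates never leave the domain of \<open>h\<close>, so the objective is finite on
  every path.\<close>

lemma mean_objective:
  "ereal_expectation M (\<lambda>\<omega>. ereal (f (x k \<omega>)) + separable_sum h (x k \<omega>))
    = ereal (history_mean k (\<lambda>\<sigma>. \<Phi> (x k (rep \<sigma>))))"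
proof (rule ereal_expectation_history[OF coords])
  fix \<omega> assume \<omega>: "\<omega> \<in> space M"
  have "x k \<omega> $ i \<in> D i" for i
    using tree.X_in_D[of k "history c k \<omega>" i] by (simp add: rep_history(1)[OF \<omega>, symmetric])
  then show "ereal (f (x k \<omega>)) + separable_sum h (x k \<omega>)
      = ereal (\<Phi> (x k (rep (history c k \<omega>))))"
    by (simp only: objective_eq rep_history(1)[OF \<omega>, symmetric])
qed

lemma mean_distance:
  "(\<integral>\<omega>. (norm (z k \<omega> - xs))\<^sup>2 \<partial>M) = history_mean k (\<lambda>\<sigma>. (norm (z k (rep \<sigma>) - xs))\<^sup>2)"
  by (intro has_bochner_integral_integral_eq has_bochner_integral_history[OF coords])
    (simp add: rep_history(2)[symmetric])

end

section \<open>The degenerate start and parameter estimates\<close>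

lemma objective_infinite_at_0:
  assumes "h i (0 :: real) = \<infinity>" "\<And>i. proper_fun (h i)"
  shows "ereal a + separable_sum h 0 = \<infinity>"
proof -
  have "separable_sum h 0 = \<infinity>"
    using assms(1) by (auto simp: separable_sum_def sum_Pinfty)
  then show ?thesis by simp
qed

text \<open>With \<open>\<tau> \<le> n\<close>, the quantity \<open>2 * n + k\<close> grows within
  one window by at most the factor \<open>3 / 2\<close>; its square is the constant for part
  (i).\<close>

lemma delay_ratio:
  assumes "m \<le> k" "k \<le> m + \<tau>" "real \<tau> \<le> n" "1 \<le> n"
  shows "((2 * n + real k) / 2)\<^sup>2 \<le> 9 / 4 * ((2 * n + real m) / 2)\<^sup>2"
proof -
  have "real k \<le> real m + real \<tau>"
    using assms(2) by linarith
  then have "2 * n + real k \<le> 3 / 2 * (2 * n + real m)"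
    using assms(3,4) by simp
  then have "((2 * n + real k) / 2)\<^sup>2 \<le> (3 / 2 * ((2 * n + real m) / 2))\<^sup>2"
    using assms by (intro power_mono) auto
  then show ?thesis unfolding power_mult_distrib by (simp add: power2_eq_square)
qed

text \<open>With \<open>a = \<gamma> * \<mu>\<close>, \<open>n * t\<close> is the positive root of
  \<open>r\<^sup>2 + a * r = a\<close>. The bound \<open>1 / 2\<close> comes from
  \<open>a\<^sup>2 + 4 * a \<le> (1 + a)\<^sup>2\<close>, which is
  \<open>a \<le> 1 / 2\<close>.\<close>

lemma parameter_root:
  fixes a n :: real
  assumes "0 < a" "a \<le> 1 / 2" "1 \<le> n"
  defines "t \<equiv> (- a + sqrt (a\<^sup>2 + 4 * a)) / (2 * n)"
  shows "(n * t)\<^sup>2 + a * (n * t) = a" "0 < t" "n * t \<le> 1 / 2"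
proof -
  let ?r = "sqrt (a\<^sup>2 + 4 * a)"
  have nt: "n * t = (?r - a) / 2" using assms by (simp add: t_def)
  have r: "?r\<^sup>2 = a\<^sup>2 + 4 * a" using assms by simp
  show "(n * t)\<^sup>2 + a * (n * t) = a"
    unfolding nt using r by (simp add: power2_eq_square field_simps)
  have "sqrt (a\<^sup>2) < ?r" using assms by (intro real_sqrt_less_mono) simp
  then show "0 < t" using assms by (simp add: t_def)
  have "?r \<le> sqrt ((1 + a)\<^sup>2)"
    using assms by (intro real_sqrt_le_mono) (simp add: power2_eq_square algebra_simps)
  then show "n * t \<le> 1 / 2" using assms by (simp add: nt)
qed

theorem theorem2:
  fixes f :: "real ^ 'n::finite \<Rightarrow> real"
    and h :: "'n \<Rightarrow> real \<Rightarrow> ereal"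
    and F :: "real ^ 'n \<Rightarrow> ereal"
    and Lc \<gamma> :: real
    and \<theta> :: "nat \<Rightarrow> real"
    and \<tau> :: nat
    and j :: "nat \<Rightarrow> nat"
    and xs :: "real ^ 'n"
    and M :: "'a measure"
    and c :: "nat \<Rightarrow> 'a \<Rightarrow> 'n"
    and x z :: "nat \<Rightarrow> 'a \<Rightarrow> real ^ 'n"
    and n :: real
  defines "n \<equiv> real CARD('n)"
    and "F \<equiv> (\<lambda>u. ereal (f u) + separable_sum h u)"
  assumes f_convex: "convex_on UNIV f"
    and f_diff: "\<And>u. f differentiable (at u)"
    and f_lip: "coord_lipschitz f Lc"
    and h_proper: "\<And>i. proper_fun (h i)"
    and h_lsc: "\<And>i. lower_semicontinuous (h i)"
    and h_convex: "\<And>i. ereal_convex (h i)"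
    and minimizer: "\<And>u. F xs \<le> F u"
    and step: "\<gamma> > 0"
    and delay: "\<And>k. k - \<tau> \<le> j k \<and> j k \<le> k"
    and delay_bound: "real \<tau> \<le> sqrt n"
    and coords: "uniform_coordinates M c"
    and iterates: "\<And>\<omega>. \<omega> \<in> space M \<Longrightarrow>
          aascd_path f h \<theta> \<gamma> j (\<lambda>k. c k \<omega>) (\<lambda>k. x k \<omega>) (\<lambda>k. z k \<omega>)"
  shows
    "(2 * \<gamma> * Lc + (1 + 1 / n) * \<gamma> * Lc * ((real \<tau>^2 + real \<tau>) / n + 2 * real \<tau>)^2 \<le> 1 \<and>
      (\<forall>k. \<theta> k = 2 / (2 * n + real k)) \<longrightarrow>
      (\<forall>K.
        (ereal_expectation M (\<lambda>\<omega>. F (x (K + 1) \<omega>)) - F xs) / ereal ((\<theta> K)^2)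
          + ereal (n^2 / (2 * \<gamma>) * prob_space.expectation M (\<lambda>\<omega>. (norm (z (K + 1) \<omega> - xs))^2))
        \<le> (F 0 - F xs) / ereal ((2 / (2 * n - 1))^2)
          + ereal (n^2 / (2 * \<gamma>) * (norm (0 - xs))^2)))
     \<and>
     (\<forall>\<mu> t.
        strongly_convex (separable_sum h) \<mu> \<and> 0 < \<mu> \<and> \<mu> \<le> Lc \<and>
        2 * \<gamma> * Lc + (3 / 4 + 3 / (8 * n)) * \<gamma> * Lc * ((real \<tau>^2 + real \<tau>) / n + 2 * real \<tau>)^2 \<le> 1 \<and>
        t = (- \<gamma> * \<mu> + sqrt (\<gamma>^2 * \<mu>^2 + 4 * \<gamma> * \<mu>)) / (2 * n) \<and>
        (\<forall>k. \<theta> k = t) \<longrightarrow>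
        (\<forall>K.
          ereal_expectation M (\<lambda>\<omega>. F (x (K + 1) \<omega>)) - F xs
          \<le> ereal ((1 - t)^(K + 1)) *
             (F 0 - F xs + ereal ((n^2 * t^2 + n * t * \<mu> * \<gamma>) / (2 * \<gamma>) * (norm (0 - xs))^2))))"
proof (intro conjI impI allI)
  have n1: "1 \<le> n" by (simp add: n_def Suc_leI)
  have "sqrt n \<le> n"
    using n1 by (intro real_le_lsqrt) (simp_all add: power2_eq_square)
  with delay_bound have \<tau>n: "real \<tau> \<le> n" by simp
  have L0: "0 \<le> Lc" by (rule coord_lipschitz_nonneg[OF f_lip])
  have F0: "F 0 = \<infinity>" if "\<not> (\<forall>i. h i 0 \<noteq> \<infinity>)"
    using that objective_infinite_at_0[of h] h_proper by (auto simp: F_def)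
  have process: "aascd_process f h \<theta> Lc \<gamma> \<mu> n j \<tau> xs M c x z"
    if "\<forall>i. h i 0 \<noteq> \<infinity>" "\<And>m. 0 < \<theta> m" "\<And>m. \<theta> m \<le> 1 / n" "\<And>m. \<theta> (Suc m) \<le> \<theta> m"
      "\<And>i. convex_on {t. h i t \<noteq> \<infinity>} (\<lambda>t. real_of_ereal (h i t) - \<mu> / 2 * t\<^sup>2)" for \<mu>
    using that f_convex f_diff f_lip h_proper h_convex minimizer step delay coords iterates
    by (intro aascd_process.intro) (auto simp: n_def F_def)
  let ?S = "(real \<tau>^2 + real \<tau>) / n + 2 * real \<tau>"

  \<comment> \<open>Part (i): the convex case with decreasing parameters\<close>
  {
    fix K
    assume *: "2 * \<gamma> * Lc + (1 + 1 / n) * \<gamma> * Lc * ?S^2 \<le> 1 \<and> (\<forall>k. \<theta> k = 2 / (2 * n + real k))"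
    then have \<theta>_eq: "\<theta> k = 2 / (2 * n + real k)" for k by blast
    show "(ereal_expectation M (\<lambda>\<omega>. F (x (K + 1) \<omega>)) - F xs) / ereal ((\<theta> K)^2)
          + ereal (n^2 / (2 * \<gamma>) * prob_space.expectation M (\<lambda>\<omega>. (norm (z (K + 1) \<omega> - xs))^2))
        \<le> (F 0 - F xs) / ereal ((2 / (2 * n - 1))^2)
          + ereal (n^2 / (2 * \<gamma>) * (norm (0 - xs))^2)"
    proof (cases "\<forall>i. h i 0 \<noteq> \<infinity>")
      case False
      \<comment> \<open>In \<open>ereal\<close>, \<open>\<infinity>\<close> minus anything is
        \<open>\<infinity>\<close>, and dividing by a positive real keeps it, so the right-hand side
        is infinite.\<close>
      have "0 < (2 / (2 * n - 1))^2" using n1 by simp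
      with F0[OF False] show ?thesis by simp
    next
      case True
      have \<theta>_pos: "0 < \<theta> m" for m using n1 by (simp add: \<theta>_eq)
      interpret aascd_process f h \<theta> Lc \<gamma> 0 n j \<tau> xs M c x z
      proof (rule process[OF True \<theta>_pos])
        show "\<theta> m \<le> 1 / n" for m using n1 by (simp add: \<theta>_eq field_simps)
        show "\<theta> (Suc m) \<le> \<theta> m" for m using n1 by (simp add: \<theta>_eq field_simps)
        show "convex_on {t. h i t \<noteq> \<infinity>} (\<lambda>t. real_of_ereal (h i t) - 0 / 2 * t\<^sup>2)" for i
          using convex_on_real_of_ereal[of "h i" "\<lambda>_. 0"] h_convex[of i] h_proper[of i]
          by (simp add: proper_fun_def zero_ereal_def[symmetric])
      qed
      \<comment> \<open>The index is shifted by one: \<open>W k\<close> is the inverse square of the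
        parameter with index \<open>k - 1\<close>, including index -1 for
        \<open>k = 0\<close>.\<close>
      define W where "W k = ((2 * n + real k - 1) / 2)\<^sup>2" for k
      have W_Suc: "W (Suc k) = 1 / (\<theta> k)\<^sup>2" for k
        by (simp add: W_def \<theta>_eq power_divide)
      have "W (K + 1) * (history_mean (K + 1) (\<lambda>\<sigma>. \<Phi> (x (K + 1) (rep \<sigma>))) - \<Phi> xs)
          + n\<^sup>2 / (2 * \<gamma>) * history_mean (K + 1) (\<lambda>\<sigma>. (norm (z (K + 1) (rep \<sigma>) - xs))\<^sup>2)
        \<le> W 0 * (\<Phi> 0 - \<Phi> xs) + n\<^sup>2 / (2 * \<gamma>) * (norm xs)\<^sup>2"
      proof (rule order_trans[OF tree.mean_bound[where W = W and B = "\<lambda>_. n\<^sup>2 / (2 * \<gamma>)" and \<rho> = "9 / 4"]])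
        show "0 \<le> W k" for k by (simp add: W_def)
        show "W (Suc k) * (1 - \<theta> k) \<le> W k" for k
        proof -
          have "W (Suc k) * (1 - \<theta> k) = W k - 1 / 4"
            using n1 by (simp add: W_def \<theta>_eq field_simps power2_eq_square)
          then show ?thesis by simp
        qed
        show "n\<^sup>2 / (2 * \<gamma>) = W (Suc k) * (n * (n * (\<theta> k)\<^sup>2 / (2 * \<gamma>) + \<theta> k * 0 / 2))" for k
          using \<theta>_pos[of k] by (simp add: W_Suc power2_eq_square)
        show "W (Suc k) * ((n - 1) * (n * (\<theta> k)\<^sup>2 / (2 * \<gamma>) + \<theta> k * 0 / 2) + n * (\<theta> k)\<^sup>2 / (2 * \<gamma>))
            \<le> n\<^sup>2 / (2 * \<gamma>)" for k
          using \<theta>_pos[of k] step by (simp add: W_Suc field_simps power2_eq_square)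
        show "W (Suc k) \<le> 9 / 4 * W (Suc m)" if "m \<le> k" "k \<le> m + \<tau>" for k m
          using delay_ratio[OF that \<tau>n n1] by (simp add: W_def)
        \<comment> \<open>The growth constant \<open>9 / 4\<close>, divided by 4, is below the
          factor 1 allowed by the step size condition.\<close>
        have "(1 + 1 / n) * (9 / 4) / 4 * (\<gamma> * Lc * ?S\<^sup>2) \<le> (1 + 1 / n) * (\<gamma> * Lc * ?S\<^sup>2)"
          using n1 step L0 by (intro mult_right_mono) (auto simp: field_simps)
        moreover have "2 * \<gamma> * Lc + (1 + 1 / n) * (\<gamma> * Lc * ?S\<^sup>2) \<le> 1"
          using * by (simp add: mult.assoc)
        ultimately have "2 * \<gamma> * Lc + (1 + 1 / n) * (9 / 4) / 4 * (\<gamma> * Lc * ?S\<^sup>2) \<le> 1"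
          by linarith
        then show "2 * \<gamma> * Lc + (1 + 1 / n) * (9 / 4) / 4 * \<gamma> * Lc * ?S\<^sup>2 \<le> 1"
          by (simp only: mult.assoc)
      qed simp
      moreover have "F xs = ereal (\<Phi> xs)" "F 0 = ereal (\<Phi> 0)"
        unfolding F_def using xs_in_D True by (intro objective_eq; simp)+
      moreover have "ereal_expectation M (\<lambda>\<omega>. F (x (K + 1) \<omega>))
          = ereal (history_mean (K + 1) (\<lambda>\<sigma>. \<Phi> (x (K + 1) (rep \<sigma>))))"
        unfolding F_def by (rule mean_objective)
      moreover have "W 0 = 1 / (2 / (2 * n - 1))\<^sup>2" by (simp add: W_def power_divide)
      moreover have "(2 / (2 * n - 1))\<^sup>2 \<noteq> 0" "(\<theta> K)\<^sup>2 \<noteq> 0"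
        using n1 \<theta>_pos[of K] by auto
      ultimately show ?thesis
        using W_Suc[of K] by (simp add: mean_distance)
    qed
  }

  \<comment> \<open>Part (ii): the strongly convex case with constant parameter\<close>
  {
    fix \<mu> t K
    assume *: "strongly_convex (separable_sum h) \<mu> \<and> 0 < \<mu> \<and> \<mu> \<le> Lc \<and>
        2 * \<gamma> * Lc + (3 / 4 + 3 / (8 * n)) * \<gamma> * Lc * ?S^2 \<le> 1 \<and>
        t = (- \<gamma> * \<mu> + sqrt (\<gamma>^2 * \<mu>^2 + 4 * \<gamma> * \<mu>)) / (2 * n) \<and> (\<forall>k. \<theta> k = t)"
    then have \<mu>: "strongly_convex (separable_sum h) \<mu>" "0 < \<mu>" "\<mu> \<le> Lc"
      and size: "2 * \<gamma> * Lc + (3 / 4 + 3 / (8 * n)) * (\<gamma> * Lc * ?S\<^sup>2) \<le> 1"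
      and t: "t = (- (\<gamma> * \<mu>) + sqrt ((\<gamma> * \<mu>)\<^sup>2 + 4 * (\<gamma> * \<mu>))) / (2 * n)"
      and \<theta>_eq: "\<And>k. \<theta> k = t"
      by (simp_all add: mult.assoc power_mult_distrib)
    \<comment> \<open>The delay term is nonnegative, so the step size condition bounds
      \<open>\<gamma> * Lc\<close>, and with it \<open>\<gamma> * \<mu>\<close>, by
      \<open>1 / 2\<close>.\<close>
    have "0 \<le> (3 / 4 + 3 / (8 * n)) * (\<gamma> * Lc * ?S\<^sup>2)"
      using n1 step L0 by simp
    moreover have "\<gamma> * \<mu> \<le> \<gamma> * Lc" using step \<mu> by simp
    ultimately have "\<gamma> * \<mu> \<le> 1 / 2"
      using size unfolding mult.assoc[of 2] by linarith
    moreover have "0 < \<gamma> * \<mu>" using step \<mu>(2) by simp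
    ultimately have a: "0 < \<gamma> * \<mu>" "\<gamma> * \<mu> \<le> 1 / 2" by blast+
    note root = parameter_root[OF a n1, folded t]
    have "t \<le> n * t" using n1 root(2) by simp
    with root(3) have t1: "t \<le> 1 / 2" by linarith
    show "ereal_expectation M (\<lambda>\<omega>. F (x (K + 1) \<omega>)) - F xs
          \<le> ereal ((1 - t)^(K + 1)) *
             (F 0 - F xs + ereal ((n^2 * t^2 + n * t * \<mu> * \<gamma>) / (2 * \<gamma>) * (norm (0 - xs))^2))"
    proof (cases "\<forall>i. h i 0 \<noteq> \<infinity>")
      case False
      show ?thesis using t1 by (simp add: F0[OF False])
    next
      case True
      \<comment> \<open>The minimizer is the base point for coordinatewise strong convexity, so its
        finiteness must come before the interpretation.\<close>
      have "F xs \<noteq> \<infinity>"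
      proof -
        have "F 0 \<noteq> \<infinity>" using True by (simp add: F_def separable_sum_def sum_Pinfty)
        with minimizer[of 0] show ?thesis by auto
      qed
      then have xs_fin: "h i (xs $ i) \<noteq> \<infinity>" for i
        by (auto simp: F_def separable_sum_def sum_Pinfty)
      interpret aascd_process f h \<theta> Lc \<gamma> \<mu> n j \<tau> xs M c x z
      proof (rule process[OF True])
        show "0 < \<theta> m" "\<theta> m \<le> 1 / n" "\<theta> (Suc m) \<le> \<theta> m" for m
          using root n1 by (simp_all add: \<theta>_eq field_simps)
        show "convex_on {t. h i t \<noteq> \<infinity>} (\<lambda>t. real_of_ereal (h i t) - \<mu> / 2 * t\<^sup>2)" for i
          using h_proper by (intro strongly_convex_coordinate[OF \<mu>(1) _ xs_fin]) (simp add: proper_fun_def)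
      qed
      define A where "A = n * t\<^sup>2 / (2 * \<gamma>) + t * \<mu> / 2"
      define W where "W k = 1 / (1 - t) ^ k" for k
      have W_pos: "0 < W k" for k using t1 by (simp add: W_def)
      have W: "W (Suc k) * (1 - t) = W k" for k using t1 by (simp add: W_def)
      \<comment> \<open>This identity explains the choice of \<open>t\<close>: it makes the distance
        term contract by the same factor \<open>1 - t\<close> as the objective, and reduces to the
        quadratic equation for \<open>n * t\<close>.\<close>
      have A: "(n - 1) * A + n * t\<^sup>2 / (2 * \<gamma>) = (1 - t) * (n * A)"
      proof -
        have "n * t * A = t / (2 * \<gamma>) * ((n * t)\<^sup>2 + \<gamma> * \<mu> * (n * t))"
          using step by (simp add: A_def field_simps power2_eq_square)
        also have "\<dots> = t * \<mu> / 2" unfolding root(1) using step by simp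
        finally have "n * t * A = t * \<mu> / 2" .
        moreover have "(1 - t) * (n * A) = n * A - n * t * A" by (simp add: algebra_simps)
        moreover have "(n - 1) * A = n * A - (n * t\<^sup>2 / (2 * \<gamma>) + t * \<mu> / 2)"
          by (simp add: A_def[symmetric] left_diff_distrib)
        ultimately show ?thesis by linarith
      qed
      have "W (K + 1) * (history_mean (K + 1) (\<lambda>\<sigma>. \<Phi> (x (K + 1) (rep \<sigma>))) - \<Phi> xs)
          + W (K + 1) * (n * A) * history_mean (K + 1) (\<lambda>\<sigma>. (norm (z (K + 1) (rep \<sigma>) - xs))\<^sup>2)
        \<le> W 0 * (\<Phi> 0 - \<Phi> xs) + W 0 * (n * A) * (norm xs)\<^sup>2"
      proof (rule order_trans[OF tree.mean_bound[where W = W and B = "\<lambda>k. W k * (n * A)" and \<rho> = 2]])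
        show "0 \<le> W k" for k using W_pos[of k] by simp
        show "W (Suc k) * (1 - \<theta> k) \<le> W k" for k by (simp add: \<theta>_eq W)
        show "W (Suc k) * (n * A) = W (Suc k) * (n * (n * (\<theta> k)\<^sup>2 / (2 * \<gamma>) + \<theta> k * \<mu> / 2))" for k
          by (simp add: \<theta>_eq A_def)
        show "W (Suc k) * ((n - 1) * (n * (\<theta> k)\<^sup>2 / (2 * \<gamma>) + \<theta> k * \<mu> / 2) + n * (\<theta> k)\<^sup>2 / (2 * \<gamma>))
            \<le> W k * (n * A)" for k
          unfolding \<theta>_eq A_def[symmetric] A by (simp add: mult.assoc[symmetric] W)
        \<comment> \<open>By Bernoulli, \<open>(1 - t) ^ (k - m)\<close> is at least
          \<open>1 - n * t \<ge> 1 / 2\<close> within a window, so the weights at most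
          double.\<close>
        show "W (Suc k) \<le> 2 * W (Suc m)" if km: "m \<le> k" "k \<le> m + \<tau>" for k m
        proof -
          have "real (k - m) * t \<le> n * t"
            using km \<tau>n root(2) by (intro mult_right_mono) auto
          then have "1 / 2 \<le> 1 + real (k - m) * (- t)" using root(3) by simp
          also have "\<dots> \<le> (1 + (- t)) ^ (k - m)" using t1 by (intro Bernoulli_inequality) simp
          finally have "1 \<le> 2 * (1 - t) ^ (k - m)" by simp
          then have "W (Suc k) * 1 \<le> W (Suc k) * (2 * (1 - t) ^ (k - m))"
            using W_pos[of "Suc k"] by (intro mult_left_mono) auto
          also have "\<dots> = 2 * W (Suc m)"
          proof -
            have "(1 - t) ^ Suc k = (1 - t) ^ (k - m) * (1 - t) ^ Suc m"
              unfolding power_add[symmetric] using km(1) by simp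
            then show ?thesis using t1 by (simp add: W_def)
          qed
          finally show ?thesis by simp
        qed
        \<comment> \<open>The left factor is \<open>1 / 2 + 1 / (2 * n)\<close>; the comparison
          amounts to \<open>1 / (8 * n) \<le> 1 / 4\<close>.\<close>
        have "(1 + 1 / n) * 2 / 4 * (\<gamma> * Lc * ?S\<^sup>2) \<le> (3 / 4 + 3 / (8 * n)) * (\<gamma> * Lc * ?S\<^sup>2)"
          using n1 step L0 by (intro mult_right_mono) (auto simp: field_simps)
        with size have "2 * \<gamma> * Lc + (1 + 1 / n) * 2 / 4 * (\<gamma> * Lc * ?S\<^sup>2) \<le> 1"
          by linarith
        then show "2 * \<gamma> * Lc + (1 + 1 / n) * 2 / 4 * \<gamma> * Lc * ?S\<^sup>2 \<le> 1"
          by (simp only: mult.assoc)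
      qed simp
      \<comment> \<open>The final bound concerns the objective alone, so the nonnegative distance
        term is dropped.\<close>
      moreover have "0 \<le> W (K + 1) * (n * A) * history_mean (K + 1) (\<lambda>\<sigma>. (norm (z (K + 1) (rep \<sigma>) - xs))\<^sup>2)"
        using W_pos[of "K + 1"] n1 step \<mu>(2) root(2)
        by (intro mult_nonneg_nonneg history_mean_nonneg) (auto simp: A_def)
      ultimately have "W (K + 1) * (history_mean (K + 1) (\<lambda>\<sigma>. \<Phi> (x (K + 1) (rep \<sigma>))) - \<Phi> xs)
          \<le> \<Phi> 0 - \<Phi> xs + n * A * (norm xs)\<^sup>2"
        by (simp add: W_def)
      then have "history_mean (K + 1) (\<lambda>\<sigma>. \<Phi> (x (K + 1) (rep \<sigma>))) - \<Phi> xs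
          \<le> (1 - t) ^ (K + 1) * (\<Phi> 0 - \<Phi> xs + n * A * (norm xs)\<^sup>2)"
        using t1 by (simp add: W_def divide_le_eq mult.commute)
      moreover have "F xs = ereal (\<Phi> xs)" "F 0 = ereal (\<Phi> 0)"
        unfolding F_def using xs_in_D True by (intro objective_eq; simp)+
      moreover have "ereal_expectation M (\<lambda>\<omega>. F (x (K + 1) \<omega>))
          = ereal (history_mean (K + 1) (\<lambda>\<sigma>. \<Phi> (x (K + 1) (rep \<sigma>))))"
        unfolding F_def by (rule mean_objective)
      moreover have "n * A = (n\<^sup>2 * t\<^sup>2 + n * t * \<mu> * \<gamma>) / (2 * \<gamma>)"
        using step by (simp add: A_def field_simps power2_eq_square)
      ultimately show ?thesis by simp
    qed
  }
qed

end
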